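(* Let $\Theta$ be a subcategory of $\operatorname{SMCs}$, seen as an SMC-universe where $\llbracket\cdot\rrbracket_\Theta$ is the subcategory inclusion (so that $\llbracket\Theta\rrbracket_\Theta=\Theta$). Then the higher-order CPM construction can be used to define a morphism of SMC-universes $(\operatorname{CPM},n^{\operatorname{CPM}}):\operatorname{PreCPM}[\Theta]\to\Theta$ as follows: - the functor $\operatorname{CPM}:\operatorname{PreCPM}[\Theta]\to\Theta$ is the one sending an object $(\mathcal{C},\Phi,\Xi)$ of $\operatorname{PreCPM}[\Theta]$ to the object $\operatorname{CPM}_{\Phi,\Xi}(\mathcal{C})$ of $\Theta$, and acting as the identity on morphisms (i.e. a morphism $F:(\mathcal{C},\Phi,\Xi)\to(\mathcal{C}',\Phi',\Xi')$ is sent to the restriction of $F$ to a functor $\operatorname{CPM}_{\Phi,\Xi}(\mathcal{C})\to\operatorname{CPM}_{\Phi',\Xi'}(\mathcal{C}')$); - the natural transformation $n^{\operatorname{CPM}}$ is given by the $\Phi$-folding functor $\operatorname{fld}_\Phi:\mathcal{C}\to\operatorname{CPM}_{\Phi,\Xi}(\mathcal{C})$.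
   Context: Conventions: "monoidal functor" means strict monoidal functor (and, between symmetric monoidal categories, one preserving the symmetry); associators and unitors are suppressed. An effect on $X$ is a morphism $X\to I$. $\operatorname{SMCs}$ is the category of (suitably small) symmetric monoidal categories and monoidal functors. An SMC-universe is a category $\Theta$ equipped with a faithful functor $\llbracket\cdot\rrbracket_\Theta:\Theta\to\operatorname{SMCs}$ (the underlying SMC functor) whose image $\llbracket\Theta\rrbracket_\Theta$ forms a subcategory of $\operatorname{SMCs}$. A morphism of SMC-universes $(\zeta,n^\zeta):\Theta\to\Theta'$ is a functor $\zeta:\Theta\to\Theta'$ together with a natural transformation $n^\zeta:\llbracket\cdot\rrbracket_\Theta\Rightarrow\llbracket\zeta(\cdot)\rrbracket_{\Theta'}$. Higher-order CPM construction: let $(\mathcal{D},\otimes,I)$ be a symmetric monoidal category, $G$ a finite abelian group and $\Psi$ a group homomorphism from $G$ to the monoidal automorphisms of $\mathcal{D}$. The folding functor $\operatorname{fld}_\Psi$ is the endofunctor of $\mathcal{D}$ with $\operatorname{fld}_\Psi[A]=\bigotimes_{\gamma\in G}\Psi(\gamma)[A]$ and $\operatorname{fld}_\Psi[f]=\bigotimes_{\gamma\in G}\Psi(\gamma)[f]$ (fixed ordering of $G$). If it is injective on objects, its image $\operatorname{FLD}_\Psi(\mathcal{D})$ is a symmetric monoidal category with $\operatorname{fld}_\Psi[A]\boxtimes\operatorname{fld}_\Psi[B]:=\operatorname{fld}_\Psi[A\otimes B]$, $\operatorname{fld}_\Psi[f]\boxtimes\operatorname{fld}_\Psi[g]:=\operatorname{fld}_\Psi[f\otimes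 g]$ and unit $\operatorname{fld}_\Psi[I]$. Let $\tau_A(\gamma):\bigotimes_{\delta}\Psi(\delta)[A]\to\bigotimes_{\delta}\Psi(\gamma\delta)[A]$ and $\pi_{A,B}:\operatorname{fld}_\Psi[A]\otimes\operatorname{fld}_\Psi[B]\to\operatorname{fld}_\Psi[A\otimes B]$ be the canonical permutation isomorphisms. A multi-environment structure for $\Psi$ is a family $\Xi=(\Xi_A)_{A\in\operatorname{obj}\mathcal{D}}$ of sets of effects on $\operatorname{fld}_\Psi[A]$ with: (i) $(\xi_A\otimes\xi_B)\circ\pi_{A,B}^{-1}\in\Xi_{A\otimes B}$ for all $\xi_A\in\Xi_A,\xi_B\in\Xi_B$; (ii) $\Xi_I=\{1\}$; (iii) $\Psi(\gamma)[\xi_A]=\xi_A\circ\tau_A(\gamma)^{-1}$ for all $\xi_A\in\Xi_A$, $\gamma\in G$. The category $\operatorname{CPM}_{\Psi,\Xi}(\mathcal{D})$ is the smallest subcategory of $\mathcal{D}$ containing $\operatorname{FLD}_\Psi(\mathcal{D})$ and all maps $(\xi_A\otimes\mathrm{id}_{\operatorname{fld}_\Psi[B]})\circ\pi_{A,B}^{-1}$ with $\xi_A\in\Xi_A$; it is a symmetric monoidal category with $F\boxtimes H:=\pi_{C,D}\circ(F\otimes H)\circ\pi_{A,B}^{-1}$ for $F:\operatorname{fld}_\Psi[A]\to\operatorname{fld}_\Psi[C]$, $H:\operatorname{fld}_\Psi[B]\to\operatorname{fld}_\Psi[D]$. The category $\operatorname{PreCPM}[\Theta]$, for an SMC-universe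 $\Theta$: objects are triples $(\mathcal{C},\Phi,\Xi)$ where $\mathcal{C}$ is an object of $\Theta$; $\Phi$ is a group homomorphism from a finite abelian group $G$ to the automorphism group $\operatorname{Aut}_\Theta(\mathcal{C})$; $\Xi$ is a multi-environment structure for $\llbracket\Phi\rrbracket_\Theta:\gamma\mapsto\llbracket\Phi(\gamma)\rrbracket_\Theta$; the category $\operatorname{CPM}_{\llbracket\Phi\rrbracket_\Theta,\Xi}(\llbracket\mathcal{C}\rrbracket_\Theta)$ is an object of $\llbracket\Theta\rrbracket_\Theta$; the folding functor $\operatorname{fld}_{\llbracket\Phi\rrbracket_\Theta}:\llbracket\mathcal{C}\rrbracket_\Theta\to\operatorname{CPM}_{\llbracket\Phi\rrbracket_\Theta,\Xi}(\llbracket\mathcal{C}\rrbracket_\Theta)$ is a morphism of $\llbracket\Theta\rrbracket_\Theta$; and this folding functor is injective on objects. Morphisms $(\mathcal{C},\Phi,\Xi)\to(\mathcal{C}',\Phi',\Xi')$, when $\Phi,\Phi'$ are actions of the same group $G$, are the morphisms $F:\mathcal{C}\to\mathcal{C}'$ of $\Theta$ which are $G$-equivariant ($F\circ\Phi(\gamma)=\Phi'(\gamma)\circ F$ for all $\gamma\in G$) and such that $\llbracket F\rrbracket_\Theta$ respects the multi-environment structure ($\{\llbracket F\rrbracket_\Theta(\xi_A)\mid\xi_A\in\Xi_A\}\subseteq\Xi'_{\llbracket F\rrbracket_\Theta(A)}$ for all $A\in\operatorname{obj}\llbracket\mathcal{C}\rrbracket_\Theta$); if $\Phi,\Phi'$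 are not actions of the same group, there are no morphisms. $\operatorname{PreCPM}[\Theta]$ is an SMC-universe with underlying SMC functor sending $(\mathcal{C},\Phi,\Xi)$ to $\llbracket\mathcal{C}\rrbracket_\Theta$ and $F$ to $\llbracket F\rrbracket_\Theta$.
   Formalization: Θ is additionally assumed to contain the restriction to CPM categories of each morphism of PreCPM[Θ] whenever that restriction is a monoidal functor; for a non-full subcategory Θ the restriction can fail to lie in Θ, and the claim is then false. *)

theory Defs
  imports "HOL-Algebra.Group"
begin

section \<open>Categories\<close>

record ('a, 'b) category =
  Obj :: "'a set"
  Arr :: "'b set"
  Dom :: "'b \<Rightarrow> 'a"
  Cod :: "'b \<Rightarrow> 'a"
  Idt :: "'a \<Rightarrow> 'b"
  Comp :: "'b \<Rightarrow> 'b \<Rightarrow> 'b"  (infixl "\<cdot>\<index>" 65)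

definition Hom :: "('a, 'b, 'z) category_scheme \<Rightarrow> 'a \<Rightarrow> 'a \<Rightarrow> 'b set" where
  "Hom C A B = {f \<in> Arr C. Dom C f = A \<and> Cod C f = B}"

text \<open>Composition is written in diagram-reversed order: \<open>g \<cdot> f\<close> is \<open>f\<close> followed by \<open>g\<close>.\<close>

locale category =
  fixes C :: "('a, 'b, 'z) category_scheme"  (structure)
  assumes dom_closed: "f \<in> Arr C \<Longrightarrow> Dom C f \<in> Obj C"
    and cod_closed: "f \<in> Arr C \<Longrightarrow> Cod C f \<in> Obj C"
    and idt_hom: "A \<in> Obj C \<Longrightarrow> Idt C A \<in> Hom C A A"
    and comp_hom: "\<lbrakk>f \<in> Hom C A B; g \<in> Hom C B D\<rbrakk> \<Longrightarrow> g \<cdot> f \<in> Hom C A D"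
    and comp_idt_left: "f \<in> Hom C A B \<Longrightarrow> Idt C B \<cdot> f = f"
    and comp_idt_right: "f \<in> Hom C A B \<Longrightarrow> f \<cdot> Idt C A = f"
    and comp_assoc: "\<lbrakk>f \<in> Hom C A B; g \<in> Hom C B D; h \<in> Hom C D E\<rbrakk>
      \<Longrightarrow> (h \<cdot> g) \<cdot> f = h \<cdot> (g \<cdot> f)"

definition is_inverse :: "('a, 'b, 'z) category_scheme \<Rightarrow> 'b \<Rightarrow> 'b \<Rightarrow> bool" where
  "is_inverse C f g \<longleftrightarrow> f \<in> Arr C \<and> g \<in> Hom C (Cod C f) (Dom C f) \<and>
     g \<cdot>\<^bsub>C\<^esub> f = Idt C (Dom C f) \<and> f \<cdot>\<^bsub>C\<^esub> g = Idt C (Cod C f)"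

definition is_iso :: "('a, 'b, 'z) category_scheme \<Rightarrow> 'b \<Rightarrow> bool" where
  "is_iso C f \<longleftrightarrow> (\<exists>g. is_inverse C f g)"

definition inv_arr :: "('a, 'b, 'z) category_scheme \<Rightarrow> 'b \<Rightarrow> 'b" where
  "inv_arr C f = (THE g. is_inverse C f g)"

definition Aut :: "('a, 'b, 'z) category_scheme \<Rightarrow> 'a \<Rightarrow> 'b monoid" where
  "Aut C A = \<lparr>carrier = {f \<in> Hom C A A. is_iso C f}, monoid.mult = Comp C, one = Idt C A\<rparr>"

definition is_functor ::
  "('a, 'b, 'y) category_scheme \<Rightarrow> ('c, 'd, 'z) category_scheme \<Rightarrow> ('a \<Rightarrow> 'c) \<Rightarrow> ('b \<Rightarrow> 'd) \<Rightarrow> bool" where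
  "is_functor C D Fo Fa \<longleftrightarrow> category C \<and> category D \<and>
     (\<forall>A\<in>Obj C. Fo A \<in> Obj D) \<and>
     (\<forall>f\<in>Arr C. Fa f \<in> Hom D (Fo (Dom C f)) (Fo (Cod C f))) \<and>
     (\<forall>A\<in>Obj C. Fa (Idt C A) = Idt D (Fo A)) \<and>
     (\<forall>f\<in>Arr C. \<forall>g\<in>Arr C. Dom C g = Cod C f \<longrightarrow> Fa (g \<cdot>\<^bsub>C\<^esub> f) = Fa g \<cdot>\<^bsub>D\<^esub> Fa f)"

definition is_faithful :: "('a, 'b, 'z) category_scheme \<Rightarrow> ('b \<Rightarrow> 'd) \<Rightarrow> bool" where
  "is_faithful C Fa \<longleftrightarrow> (\<forall>f\<in>Arr C. \<forall>g\<in>Arr C.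
     Dom C f = Dom C g \<and> Cod C f = Cod C g \<and> Fa f = Fa g \<longrightarrow> f = g)"

definition natural_transformation ::
  "('a, 'b, 'y) category_scheme \<Rightarrow> ('c, 'd, 'z) category_scheme \<Rightarrow> ('a \<Rightarrow> 'c) \<Rightarrow> ('b \<Rightarrow> 'd)
    \<Rightarrow> ('a \<Rightarrow> 'c) \<Rightarrow> ('b \<Rightarrow> 'd) \<Rightarrow> ('a \<Rightarrow> 'd) \<Rightarrow> bool" where
  "natural_transformation C D Fo Fa Go Ga n \<longleftrightarrow>
     is_functor C D Fo Fa \<and> is_functor C D Go Ga \<and>
     (\<forall>A\<in>Obj C. n A \<in> Hom D (Fo A) (Go A)) \<and>
     (\<forall>f\<in>Arr C. n (Cod C f) \<cdot>\<^bsub>D\<^esub> Fa f = Ga f \<cdot>\<^bsub>D\<^esub> n (Dom C f))"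

definition subcategory :: "('a, 'b, 'y) category_scheme \<Rightarrow> ('a, 'b, 'z) category_scheme \<Rightarrow> bool" where
  "subcategory S C \<longleftrightarrow> category S \<and> category C \<and> Obj S \<subseteq> Obj C \<and> Arr S \<subseteq> Arr C \<and>
     (\<forall>f\<in>Arr S. Dom S f = Dom C f \<and> Cod S f = Cod C f) \<and>
     (\<forall>A\<in>Obj S. Idt S A = Idt C A) \<and>
     (\<forall>f\<in>Arr S. \<forall>g\<in>Arr S. Dom C g = Cod C f \<longrightarrow> g \<cdot>\<^bsub>S\<^esub> f = g \<cdot>\<^bsub>C\<^esub> f)"


section \<open>The category of symmetric monoidal categories\<close>

record ('a, 'b) smc = "('a, 'b) category" +
  TObj :: "'a \<Rightarrow> 'a \<Rightarrow> 'a"  (infixr "\<otimes>\<^sub>o\<index>" 70)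
  TArr :: "'b \<Rightarrow> 'b \<Rightarrow> 'b"  (infixr "\<otimes>\<^sub>a\<index>" 70)
  Unit :: "'a"
  Asc :: "'a \<Rightarrow> 'a \<Rightarrow> 'a \<Rightarrow> 'b"
  Lun :: "'a \<Rightarrow> 'b"
  Run :: "'a \<Rightarrow> 'b"
  Sym :: "'a \<Rightarrow> 'a \<Rightarrow> 'b"

text \<open>
  The operations of an SMC are required to be \<^const>\<open>undefined\<close> outside their domains, so that
  equality of records is equality of symmetric monoidal categories. This matters because objects of
  a subcategory of \<open>SMCs\<close> are compared by equality. Smallness is expressed by the types: all
  objects and all arrows come from two fixed but arbitrary types.
\<close>

locale smc = category C for C :: "('a, 'b) smc"  (structure) +
  assumes unit_closed: "Unit C \<in> Obj C"
    and tobj_closed: "\<lbrakk>A \<in> Obj C; B \<in> Obj C\<rbrakk> \<Longrightarrow> A \<otimes>\<^sub>o B \<in> Obj C"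
    and tarr_hom: "\<lbrakk>f \<in> Hom C A B; g \<in> Hom C A' B'\<rbrakk> \<Longrightarrow> f \<otimes>\<^sub>a g \<in> Hom C (A \<otimes>\<^sub>o A') (B \<otimes>\<^sub>o B')"
    and tarr_idt: "\<lbrakk>A \<in> Obj C; B \<in> Obj C\<rbrakk> \<Longrightarrow> Idt C A \<otimes>\<^sub>a Idt C B = Idt C (A \<otimes>\<^sub>o B)"
    and interchange: "\<lbrakk>f \<in> Hom C A B; g \<in> Hom C B D; f' \<in> Hom C A' B'; g' \<in> Hom C B' D'\<rbrakk>
      \<Longrightarrow> (g \<cdot> f) \<otimes>\<^sub>a (g' \<cdot> f') = (g \<otimes>\<^sub>a g') \<cdot> (f \<otimes>\<^sub>a f')"
    and asc_hom: "\<lbrakk>A \<in> Obj C; B \<in> Obj C; D \<in> Obj C\<rbrakk>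
      \<Longrightarrow> Asc C A B D \<in> Hom C ((A \<otimes>\<^sub>o B) \<otimes>\<^sub>o D) (A \<otimes>\<^sub>o (B \<otimes>\<^sub>o D))"
    and asc_iso: "\<lbrakk>A \<in> Obj C; B \<in> Obj C; D \<in> Obj C\<rbrakk> \<Longrightarrow> is_iso C (Asc C A B D)"
    and asc_natural: "\<lbrakk>f \<in> Hom C A A'; g \<in> Hom C B B'; h \<in> Hom C D D'\<rbrakk>
      \<Longrightarrow> Asc C A' B' D' \<cdot> ((f \<otimes>\<^sub>a g) \<otimes>\<^sub>a h) = (f \<otimes>\<^sub>a (g \<otimes>\<^sub>a h)) \<cdot> Asc C A B D"
    and lun_hom: "A \<in> Obj C \<Longrightarrow> Lun C A \<in> Hom C (Unit C \<otimes>\<^sub>o A) A"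
    and lun_iso: "A \<in> Obj C \<Longrightarrow> is_iso C (Lun C A)"
    and lun_natural: "f \<in> Hom C A B \<Longrightarrow> Lun C B \<cdot> (Idt C (Unit C) \<otimes>\<^sub>a f) = f \<cdot> Lun C A"
    and run_hom: "A \<in> Obj C \<Longrightarrow> Run C A \<in> Hom C (A \<otimes>\<^sub>o Unit C) A"
    and run_iso: "A \<in> Obj C \<Longrightarrow> is_iso C (Run C A)"
    and run_natural: "f \<in> Hom C A B \<Longrightarrow> Run C B \<cdot> (f \<otimes>\<^sub>a Idt C (Unit C)) = f \<cdot> Run C A"
    and sym_hom: "\<lbrakk>A \<in> Obj C; B \<in> Obj C\<rbrakk> \<Longrightarrow> Sym C A B \<in> Hom C (A \<otimes>\<^sub>o B) (B \<otimes>\<^sub>o A)"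
    and sym_natural: "\<lbrakk>f \<in> Hom C A A'; g \<in> Hom C B B'\<rbrakk>
      \<Longrightarrow> Sym C A' B' \<cdot> (f \<otimes>\<^sub>a g) = (g \<otimes>\<^sub>a f) \<cdot> Sym C A B"
    and sym_sym: "\<lbrakk>A \<in> Obj C; B \<in> Obj C\<rbrakk> \<Longrightarrow> Sym C B A \<cdot> Sym C A B = Idt C (A \<otimes>\<^sub>o B)"
    and triangle: "\<lbrakk>A \<in> Obj C; B \<in> Obj C\<rbrakk>
      \<Longrightarrow> (Idt C A \<otimes>\<^sub>a Lun C B) \<cdot> Asc C A (Unit C) B = Run C A \<otimes>\<^sub>a Idt C B"
    and pentagon: "\<lbrakk>A \<in> Obj C; B \<in> Obj C; D \<in> Obj C; E \<in> Obj C\<rbrakk>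
      \<Longrightarrow> Asc C A B (D \<otimes>\<^sub>o E) \<cdot> Asc C (A \<otimes>\<^sub>o B) D E
        = (Idt C A \<otimes>\<^sub>a Asc C B D E) \<cdot> Asc C A (B \<otimes>\<^sub>o D) E \<cdot> (Asc C A B D \<otimes>\<^sub>a Idt C E)"
    and hexagon: "\<lbrakk>A \<in> Obj C; B \<in> Obj C; D \<in> Obj C\<rbrakk>
      \<Longrightarrow> Asc C B D A \<cdot> Sym C A (B \<otimes>\<^sub>o D) \<cdot> Asc C A B D
        = (Idt C B \<otimes>\<^sub>a Sym C A D) \<cdot> Asc C B A D \<cdot> (Sym C A B \<otimes>\<^sub>a Idt C D)"
    and dom_undef: "f \<notin> Arr C \<Longrightarrow> Dom C f = undefined"
    and cod_undef: "f \<notin> Arr C \<Longrightarrow> Cod C f = undefined"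
    and idt_undef: "A \<notin> Obj C \<Longrightarrow> Idt C A = undefined"
    and comp_undef: "\<not> (f \<in> Arr C \<and> g \<in> Arr C \<and> Dom C g = Cod C f) \<Longrightarrow> g \<cdot> f = undefined"
    and tobj_undef: "\<not> (A \<in> Obj C \<and> B \<in> Obj C) \<Longrightarrow> A \<otimes>\<^sub>o B = undefined"
    and tarr_undef: "\<not> (f \<in> Arr C \<and> g \<in> Arr C) \<Longrightarrow> f \<otimes>\<^sub>a g = undefined"
    and asc_undef: "\<not> (A \<in> Obj C \<and> B \<in> Obj C \<and> D \<in> Obj C) \<Longrightarrow> Asc C A B D = undefined"
    and lun_undef: "A \<notin> Obj C \<Longrightarrow> Lun C A = undefined"
    and run_undef: "A \<notin> Obj C \<Longrightarrow> Run C A = undefined"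
    and sym_undef: "\<not> (A \<in> Obj C \<and> B \<in> Obj C) \<Longrightarrow> Sym C A B = undefined"

definition strict_smc :: "('a, 'b) smc \<Rightarrow> bool" where
  "strict_smc C \<longleftrightarrow> smc C \<and>
     (\<forall>A\<in>Obj C. \<forall>B\<in>Obj C. \<forall>D\<in>Obj C. (A \<otimes>\<^sub>o\<^bsub>C\<^esub> B) \<otimes>\<^sub>o\<^bsub>C\<^esub> D = A \<otimes>\<^sub>o\<^bsub>C\<^esub> (B \<otimes>\<^sub>o\<^bsub>C\<^esub> D) \<and>
        Asc C A B D = Idt C (A \<otimes>\<^sub>o\<^bsub>C\<^esub> (B \<otimes>\<^sub>o\<^bsub>C\<^esub> D))) \<and>
     (\<forall>A\<in>Obj C. Unit C \<otimes>\<^sub>o\<^bsub>C\<^esub> A = A \<and> A \<otimes>\<^sub>o\<^bsub>C\<^esub> Unit C = A \<and>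
        Lun C A = Idt C A \<and> Run C A = Idt C A)"

record ('a, 'b) smf =
  SDom :: "('a, 'b) smc"
  SCod :: "('a, 'b) smc"
  OMap :: "'a \<Rightarrow> 'a"
  AMap :: "'b \<Rightarrow> 'b"

text \<open>Strict symmetric monoidal functors between (not necessarily strict) SMCs.\<close>

definition is_smf :: "('a, 'b) smf \<Rightarrow> bool" where
  "is_smf F \<longleftrightarrow> (let C = SDom F; D = SCod F; Fo = OMap F; Fa = AMap F in
     smc C \<and> smc D \<and> is_functor C D Fo Fa \<and>
     Fo (Unit C) = Unit D \<and>
     (\<forall>A\<in>Obj C. \<forall>B\<in>Obj C. Fo (A \<otimes>\<^sub>o\<^bsub>C\<^esub> B) = Fo A \<otimes>\<^sub>o\<^bsub>D\<^esub> Fo B) \<and>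
     (\<forall>f\<in>Arr C. \<forall>g\<in>Arr C. Fa (f \<otimes>\<^sub>a\<^bsub>C\<^esub> g) = Fa f \<otimes>\<^sub>a\<^bsub>D\<^esub> Fa g) \<and>
     (\<forall>A\<in>Obj C. \<forall>B\<in>Obj C. \<forall>E\<in>Obj C. Fa (Asc C A B E) = Asc D (Fo A) (Fo B) (Fo E)) \<and>
     (\<forall>A\<in>Obj C. Fa (Lun C A) = Lun D (Fo A)) \<and>
     (\<forall>A\<in>Obj C. Fa (Run C A) = Run D (Fo A)) \<and>
     (\<forall>A\<in>Obj C. \<forall>B\<in>Obj C. Fa (Sym C A B) = Sym D (Fo A) (Fo B)) \<and>
     Fo \<in> extensional (Obj C) \<and> Fa \<in> extensional (Arr C))"

definition smf_id :: "('a, 'b) smc \<Rightarrow> ('a, 'b) smf" where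
  "smf_id C = \<lparr>SDom = C, SCod = C, OMap = (\<lambda>A\<in>Obj C. A), AMap = (\<lambda>f\<in>Arr C. f)\<rparr>"

definition smf_comp :: "('a, 'b) smf \<Rightarrow> ('a, 'b) smf \<Rightarrow> ('a, 'b) smf" where
  "smf_comp G F = \<lparr>SDom = SDom F, SCod = SCod G,
     OMap = compose (Obj (SDom F)) (OMap G) (OMap F),
     AMap = compose (Arr (SDom F)) (AMap G) (AMap F)\<rparr>"

definition SMCs :: "(('a, 'b) smc, ('a, 'b) smf) category" where
  "SMCs = \<lparr>Obj = {C. smc C}, Arr = {F. is_smf F}, Dom = SDom, Cod = SCod,
     Idt = smf_id, Comp = smf_comp\<rparr>"


section \<open>SMC-universes\<close>

record ('x, 'y, 'a, 'b) smc_universe =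
  Cat :: "('x, 'y) category"
  UObj :: "'x \<Rightarrow> ('a, 'b) smc"
  UArr :: "'y \<Rightarrow> ('a, 'b) smf"

definition underlying_image ::
  "('x, 'y, 'a, 'b) smc_universe \<Rightarrow> (('a, 'b) smc, ('a, 'b) smf) category" where
  "underlying_image U = SMCs\<lparr>Obj := UObj U ` Obj (Cat U), Arr := UArr U ` Arr (Cat U)\<rparr>"

definition smc_universe :: "('x, 'y, 'a, 'b) smc_universe \<Rightarrow> bool" where
  "smc_universe U \<longleftrightarrow> is_functor (Cat U) SMCs (UObj U) (UArr U) \<and>
     is_faithful (Cat U) (UArr U) \<and> subcategory (underlying_image U) SMCs"

definition smc_universe_morphism ::
  "('x, 'y, 'a, 'b) smc_universe \<Rightarrow> ('u, 'v, 'a, 'b) smc_universe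
    \<Rightarrow> ('x \<Rightarrow> 'u) \<Rightarrow> ('y \<Rightarrow> 'v) \<Rightarrow> ('x \<Rightarrow> ('a, 'b) smf) \<Rightarrow> bool" where
  "smc_universe_morphism U V Zo Za n \<longleftrightarrow> is_functor (Cat U) (Cat V) Zo Za \<and>
     natural_transformation (Cat U) SMCs (UObj U) (UArr U) (UObj V \<circ> Zo) (UArr V \<circ> Za) n"

definition incl_universe ::
  "(('a, 'b) smc, ('a, 'b) smf) category
    \<Rightarrow> (('a, 'b) smc, ('a, 'b) smf, 'a, 'b) smc_universe" where
  "incl_universe \<Theta> = \<lparr>Cat = \<Theta>, UObj = (\<lambda>C. C), UArr = (\<lambda>F. F)\<rparr>"


section \<open>Canonical isomorphisms\<close>

text \<open>
  Iterated tensor products are bracketed to the right, without a trailing unit; the tensor of a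
  singleton list is its entry.
\<close>

fun tens_obj :: "('a, 'b) smc \<Rightarrow> 'a list \<Rightarrow> 'a" where
  "tens_obj C [] = Unit C"
| "tens_obj C [A] = A"
| "tens_obj C (A # B # As) = A \<otimes>\<^sub>o\<^bsub>C\<^esub> tens_obj C (B # As)"

fun tens_arr :: "('a, 'b) smc \<Rightarrow> 'b list \<Rightarrow> 'b" where
  "tens_arr C [] = Idt C (Unit C)"
| "tens_arr C [f] = f"
| "tens_arr C (f # g # fs) = f \<otimes>\<^sub>a\<^bsub>C\<^esub> tens_arr C (g # fs)"

text \<open>\<open>mid4 C A X B Y : (A \<otimes> X) \<otimes> (B \<otimes> Y) \<rightarrow> (A \<otimes> B) \<otimes> (X \<otimes> Y)\<close>\<close>

definition mid4 :: "('a, 'b) smc \<Rightarrow> 'a \<Rightarrow> 'a \<Rightarrow> 'a \<Rightarrow> 'a \<Rightarrow> 'b" where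
  "mid4 C A X B Y =
     inv_arr C (Asc C A B (X \<otimes>\<^sub>o\<^bsub>C\<^esub> Y)) \<cdot>\<^bsub>C\<^esub>
     (Idt C A \<otimes>\<^sub>a\<^bsub>C\<^esub>
       (Asc C B X Y \<cdot>\<^bsub>C\<^esub> (Sym C X B \<otimes>\<^sub>a\<^bsub>C\<^esub> Idt C Y) \<cdot>\<^bsub>C\<^esub> inv_arr C (Asc C X B Y))) \<cdot>\<^bsub>C\<^esub>
     Asc C A X (B \<otimes>\<^sub>o\<^bsub>C\<^esub> Y)"

text \<open>
  For a list of pairs \<open>(A\<^sub>i, B\<^sub>i)\<close>, the isomorphism
  \<open>(\<Otimes>\<^sub>i A\<^sub>i) \<otimes> (\<Otimes>\<^sub>i B\<^sub>i) \<rightarrow> \<Otimes>\<^sub>i (A\<^sub>i \<otimes> B\<^sub>i)\<close>.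
\<close>

fun interleave :: "('a, 'b) smc \<Rightarrow> ('a \<times> 'a) list \<Rightarrow> 'b" where
  "interleave C [] = Lun C (Unit C)"
| "interleave C [(A, B)] = Idt C (A \<otimes>\<^sub>o\<^bsub>C\<^esub> B)"
| "interleave C ((A, B) # p # ps) =
     (Idt C (A \<otimes>\<^sub>o\<^bsub>C\<^esub> B) \<otimes>\<^sub>a\<^bsub>C\<^esub> interleave C (p # ps)) \<cdot>\<^bsub>C\<^esub>
     mid4 C A (tens_obj C (map fst (p # ps))) B (tens_obj C (map snd (p # ps)))"

text \<open>
  For a list \<open>xs\<close> of distinct labels containing \<open>y\<close>, the isomorphism
  \<open>\<Otimes> (map ob xs) \<rightarrow> \<Otimes> (map ob (y # remove1 y xs))\<close> moving the factor labelled \<open>y\<close> to the front.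
\<close>

fun to_front :: "('a, 'b) smc \<Rightarrow> ('g \<Rightarrow> 'a) \<Rightarrow> 'g \<Rightarrow> 'g list \<Rightarrow> 'b" where
  "to_front C ob y [] = Idt C (Unit C)"
| "to_front C ob y (x # xs) =
     (if x = y then Idt C (tens_obj C (map ob (x # xs)))
      else if remove1 y xs = [] then Sym C (ob x) (ob y)
      else let R = tens_obj C (map ob (remove1 y xs)) in
        Asc C (ob y) (ob x) R \<cdot>\<^bsub>C\<^esub> (Sym C (ob x) (ob y) \<otimes>\<^sub>a\<^bsub>C\<^esub> Idt C R) \<cdot>\<^bsub>C\<^esub>
        inv_arr C (Asc C (ob x) (ob y) R) \<cdot>\<^bsub>C\<^esub> (Idt C (ob x) \<otimes>\<^sub>a\<^bsub>C\<^esub> to_front C ob y xs))"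

text \<open>
  For a rearrangement \<open>ys\<close> of a list \<open>xs\<close> of distinct labels, the isomorphism
  \<open>\<Otimes> (map ob xs) \<rightarrow> \<Otimes> (map ob ys)\<close> sending each factor to the factor with the same label.
\<close>

fun perm_iso :: "('a, 'b) smc \<Rightarrow> ('g \<Rightarrow> 'a) \<Rightarrow> 'g list \<Rightarrow> 'g list \<Rightarrow> 'b" where
  "perm_iso C ob xs [] = Idt C (Unit C)"
| "perm_iso C ob xs [y] = Idt C (ob y)"
| "perm_iso C ob xs (y # z # zs) =
     (Idt C (ob y) \<otimes>\<^sub>a\<^bsub>C\<^esub> perm_iso C ob (remove1 y xs) (z # zs)) \<cdot>\<^bsub>C\<^esub> to_front C ob y xs"

text \<open>The canonical isomorphism from the \<open>n\<close>-fold tensor power of the unit to the unit.\<close>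

primrec unit_effect :: "('a, 'b) smc \<Rightarrow> nat \<Rightarrow> 'b" where
  "unit_effect C 0 = Idt C (Unit C)"
| "unit_effect C (Suc n) = (if n = 0 then Idt C (Unit C)
     else Lun C (Unit C) \<cdot>\<^bsub>C\<^esub> (Idt C (Unit C) \<otimes>\<^sub>a\<^bsub>C\<^esub> unit_effect C n))"


section \<open>The higher-order CPM construction\<close>

text \<open>
  Throughout, \<open>gs\<close> enumerates the elements of the group \<open>G\<close> without repetition, in the fixed
  ordering used for the folded tensor products, and \<open>\<Psi>\<close> is the action of \<open>G\<close> on \<open>C\<close>.
\<close>

definition fld_obj :: "('a, 'b) smc \<Rightarrow> 'g list \<Rightarrow> ('g \<Rightarrow> ('a, 'b) smf) \<Rightarrow> 'a \<Rightarrow> 'a" where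
  "fld_obj C gs \<Psi> A = tens_obj C (map (\<lambda>\<gamma>. OMap (\<Psi> \<gamma>) A) gs)"

definition fld_arr :: "('a, 'b) smc \<Rightarrow> 'g list \<Rightarrow> ('g \<Rightarrow> ('a, 'b) smf) \<Rightarrow> 'b \<Rightarrow> 'b" where
  "fld_arr C gs \<Psi> f = tens_arr C (map (\<lambda>\<gamma>. AMap (\<Psi> \<gamma>) f) gs)"

definition pi_iso :: "('a, 'b) smc \<Rightarrow> 'g list \<Rightarrow> ('g \<Rightarrow> ('a, 'b) smf) \<Rightarrow> 'a \<Rightarrow> 'a \<Rightarrow> 'b" where
  "pi_iso C gs \<Psi> A B = interleave C (map (\<lambda>\<gamma>. (OMap (\<Psi> \<gamma>) A, OMap (\<Psi> \<gamma>) B)) gs)"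

definition tau_iso ::
  "('a, 'b) smc \<Rightarrow> 'g monoid \<Rightarrow> 'g list \<Rightarrow> ('g \<Rightarrow> ('a, 'b) smf) \<Rightarrow> 'a \<Rightarrow> 'g \<Rightarrow> 'b" where
  "tau_iso C G gs \<Psi> A \<gamma> = perm_iso C (\<lambda>\<delta>. OMap (\<Psi> \<delta>) A) gs (map (\<lambda>\<delta>. \<gamma> \<otimes>\<^bsub>G\<^esub> \<delta>) gs)"

text \<open>
  The conditions on effects, with the unitors \<open>I \<otimes> I \<rightarrow> I\<close> and \<open>I \<otimes> \<dots> \<otimes> I \<rightarrow> I\<close> made explicit; in a
  strict SMC the latter, \<^const>\<open>unit_effect\<close>, is the identity of the unit.
\<close>

definition multi_environment ::
  "('a, 'b) smc \<Rightarrow> 'g monoid \<Rightarrow> 'g list \<Rightarrow> ('g \<Rightarrow> ('a, 'b) smf) \<Rightarrow> ('a \<Rightarrow> 'b set) \<Rightarrow> bool" where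
  "multi_environment C G gs \<Psi> \<Xi> \<longleftrightarrow>
     (\<forall>A\<in>Obj C. \<Xi> A \<subseteq> Hom C (fld_obj C gs \<Psi> A) (Unit C)) \<and>
     (\<forall>A\<in>Obj C. \<forall>B\<in>Obj C. \<forall>\<xi>\<in>\<Xi> A. \<forall>\<xi>'\<in>\<Xi> B.
        Lun C (Unit C) \<cdot>\<^bsub>C\<^esub> (\<xi> \<otimes>\<^sub>a\<^bsub>C\<^esub> \<xi>') \<cdot>\<^bsub>C\<^esub> inv_arr C (pi_iso C gs \<Psi> A B) \<in> \<Xi> (A \<otimes>\<^sub>o\<^bsub>C\<^esub> B)) \<and>
     \<Xi> (Unit C) = {unit_effect C (length gs)} \<and>
     (\<forall>A\<in>Obj C. \<forall>\<xi>\<in>\<Xi> A. \<forall>\<gamma>\<in>carrier G.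
        AMap (\<Psi> \<gamma>) \<xi> = \<xi> \<cdot>\<^bsub>C\<^esub> inv_arr C (tau_iso C G gs \<Psi> A \<gamma>))"

text \<open>
  The arrows of the smallest subcategory containing the image of the folding functor and all
  discarding maps.
\<close>

inductive_set cpm_arr ::
  "('a, 'b) smc \<Rightarrow> 'g list \<Rightarrow> ('g \<Rightarrow> ('a, 'b) smf) \<Rightarrow> ('a \<Rightarrow> 'b set) \<Rightarrow> 'b set"
  for C :: "('a, 'b) smc" and gs :: "'g list" and \<Psi> :: "'g \<Rightarrow> ('a, 'b) smf" and \<Xi> :: "'a \<Rightarrow> 'b set"
where
  fold: "f \<in> Arr C \<Longrightarrow> fld_arr C gs \<Psi> f \<in> cpm_arr C gs \<Psi> \<Xi>"
| discard: "\<lbrakk>A \<in> Obj C; B \<in> Obj C; \<xi> \<in> \<Xi> A\<rbrakk> \<Longrightarrow>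
    Lun C (fld_obj C gs \<Psi> B) \<cdot>\<^bsub>C\<^esub> (\<xi> \<otimes>\<^sub>a\<^bsub>C\<^esub> Idt C (fld_obj C gs \<Psi> B)) \<cdot>\<^bsub>C\<^esub>
      inv_arr C (pi_iso C gs \<Psi> A B) \<in> cpm_arr C gs \<Psi> \<Xi>"
| idt: "A \<in> Obj C \<Longrightarrow> Idt C (fld_obj C gs \<Psi> A) \<in> cpm_arr C gs \<Psi> \<Xi>"
| comp: "\<lbrakk>f \<in> cpm_arr C gs \<Psi> \<Xi>; g \<in> cpm_arr C gs \<Psi> \<Xi>; Dom C g = Cod C f\<rbrakk>
    \<Longrightarrow> g \<cdot>\<^bsub>C\<^esub> f \<in> cpm_arr C gs \<Psi> \<Xi>"

text \<open>
  Below, \<open>unf\<close> recovers \<open>A\<close> from \<open>fld_obj C gs \<Psi> A\<close>, which is unambiguous only if the folding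
  functor is injective on objects. The structural isomorphisms are the foldings of those of \<open>C\<close>,
  as for the symmetric monoidal structure on the image of the folding functor.
\<close>

definition CPM ::
  "('a, 'b) smc \<Rightarrow> 'g list \<Rightarrow> ('g \<Rightarrow> ('a, 'b) smf) \<Rightarrow> ('a \<Rightarrow> 'b set) \<Rightarrow> ('a, 'b) smc" where
  "CPM C gs \<Psi> \<Xi> =
    (let O' = fld_obj C gs \<Psi> ` Obj C;
         M = cpm_arr C gs \<Psi> \<Xi>;
         unf = inv_into (Obj C) (fld_obj C gs \<Psi>);
         fa = fld_arr C gs \<Psi>
     in \<lparr>Obj = O', Arr = M,
         Dom = (\<lambda>f\<in>M. Dom C f), Cod = (\<lambda>f\<in>M. Cod C f), Idt = (\<lambda>X\<in>O'. Idt C X),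
         Comp = (\<lambda>g f. if f \<in> M \<and> g \<in> M \<and> Dom C g = Cod C f then g \<cdot>\<^bsub>C\<^esub> f else undefined),
         TObj = (\<lambda>X Y. if X \<in> O' \<and> Y \<in> O' then fld_obj C gs \<Psi> (unf X \<otimes>\<^sub>o\<^bsub>C\<^esub> unf Y) else undefined),
         TArr = (\<lambda>f h. if f \<in> M \<and> h \<in> M
           then pi_iso C gs \<Psi> (unf (Cod C f)) (unf (Cod C h)) \<cdot>\<^bsub>C\<^esub> (f \<otimes>\<^sub>a\<^bsub>C\<^esub> h) \<cdot>\<^bsub>C\<^esub>
                inv_arr C (pi_iso C gs \<Psi> (unf (Dom C f)) (unf (Dom C h)))
           else undefined),
         Unit = fld_obj C gs \<Psi> (Unit C),
         Asc = (\<lambda>X Y Z. if X \<in> O' \<and> Y \<in> O' \<and> Z \<in> O'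
           then fa (Asc C (unf X) (unf Y) (unf Z)) else undefined),
         Lun = (\<lambda>X\<in>O'. fa (Lun C (unf X))),
         Run = (\<lambda>X\<in>O'. fa (Run C (unf X))),
         Sym = (\<lambda>X Y. if X \<in> O' \<and> Y \<in> O' then fa (Sym C (unf X) (unf Y)) else undefined)\<rparr>)"

definition fld :: "('a, 'b) smc \<Rightarrow> 'g list \<Rightarrow> ('g \<Rightarrow> ('a, 'b) smf) \<Rightarrow> ('a \<Rightarrow> 'b set) \<Rightarrow> ('a, 'b) smf" where
  "fld C gs \<Psi> \<Xi> = \<lparr>SDom = C, SCod = CPM C gs \<Psi> \<Xi>,
     OMap = (\<lambda>A\<in>Obj C. fld_obj C gs \<Psi> A), AMap = (\<lambda>f\<in>Arr C. fld_arr C gs \<Psi> f)\<rparr>"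


section \<open>The SMC-universe PreCPM\<close>

record ('x, 'y, 'g, 'a, 'b) precpm =
  Base :: 'x
  Grp :: "'g monoid"
  Act :: "'g \<Rightarrow> 'y"
  Env :: "'a \<Rightarrow> 'b set"

record ('x, 'y, 'g, 'a, 'b) precpm_map =
  PDom :: "('x, 'y, 'g, 'a, 'b) precpm"
  PCod :: "('x, 'y, 'g, 'a, 'b) precpm"
  PMap :: 'y

text \<open>\<open>ord\<close> chooses the ordering of every finite group.\<close>

definition fld_obj_of ::
  "('g monoid \<Rightarrow> 'g list) \<Rightarrow> ('x, 'y, 'a, 'b) smc_universe \<Rightarrow> ('x, 'y, 'g, 'a, 'b) precpm
    \<Rightarrow> 'a \<Rightarrow> 'a" where
  "fld_obj_of ord U X = fld_obj (UObj U (Base X)) (ord (Grp X)) (\<lambda>\<gamma>. UArr U (Act X \<gamma>))"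

definition cpm_of ::
  "('g monoid \<Rightarrow> 'g list) \<Rightarrow> ('x, 'y, 'a, 'b) smc_universe \<Rightarrow> ('x, 'y, 'g, 'a, 'b) precpm
    \<Rightarrow> ('a, 'b) smc" where
  "cpm_of ord U X = CPM (UObj U (Base X)) (ord (Grp X)) (\<lambda>\<gamma>. UArr U (Act X \<gamma>)) (Env X)"

definition fld_of ::
  "('g monoid \<Rightarrow> 'g list) \<Rightarrow> ('x, 'y, 'a, 'b) smc_universe \<Rightarrow> ('x, 'y, 'g, 'a, 'b) precpm
    \<Rightarrow> ('a, 'b) smf" where
  "fld_of ord U X = fld (UObj U (Base X)) (ord (Grp X)) (\<lambda>\<gamma>. UArr U (Act X \<gamma>)) (Env X)"

text \<open>
  The conditions on values outside the carrier of the group, respectively outside the objects of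
  the underlying SMC, make equality of records the equality of the intended triples; in particular
  equality of the \<^const>\<open>Grp\<close> components is equality of groups.
\<close>

definition precpm_object ::
  "('g monoid \<Rightarrow> 'g list) \<Rightarrow> ('x, 'y, 'a, 'b) smc_universe \<Rightarrow> ('x, 'y, 'g, 'a, 'b) precpm
    \<Rightarrow> bool" where
  "precpm_object ord U X \<longleftrightarrow> (let C = UObj U (Base X); G = Grp X in
     Base X \<in> Obj (Cat U) \<and>
     comm_group G \<and> finite (carrier G) \<and>
     (\<forall>\<gamma> \<delta>. \<not> (\<gamma> \<in> carrier G \<and> \<delta> \<in> carrier G) \<longrightarrow> \<gamma> \<otimes>\<^bsub>G\<^esub> \<delta> = undefined) \<and>
     Act X \<in> hom G (Aut (Cat U) (Base X)) \<and> Act X \<in> extensional (carrier G) \<and>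
     multi_environment C G (ord G) (\<lambda>\<gamma>. UArr U (Act X \<gamma>)) (Env X) \<and>
     (\<forall>A. A \<notin> Obj C \<longrightarrow> Env X A = {}) \<and>
     cpm_of ord U X \<in> UObj U ` Obj (Cat U) \<and>
     fld_of ord U X \<in> UArr U ` Arr (Cat U) \<and>
     inj_on (fld_obj_of ord U X) (Obj C))"

definition precpm_arrow ::
  "('g monoid \<Rightarrow> 'g list) \<Rightarrow> ('x, 'y, 'a, 'b) smc_universe \<Rightarrow> ('x, 'y, 'g, 'a, 'b) precpm_map
    \<Rightarrow> bool" where
  "precpm_arrow ord U F \<longleftrightarrow> (let X = PDom F; Y = PCod F; f = PMap F in
     precpm_object ord U X \<and> precpm_object ord U Y \<and> Grp X = Grp Y \<and>
     f \<in> Hom (Cat U) (Base X) (Base Y) \<and>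
     (\<forall>\<gamma>\<in>carrier (Grp X). f \<cdot>\<^bsub>Cat U\<^esub> Act X \<gamma> = Act Y \<gamma> \<cdot>\<^bsub>Cat U\<^esub> f) \<and>
     (\<forall>A\<in>Obj (UObj U (Base X)). AMap (UArr U f) ` Env X A \<subseteq> Env Y (OMap (UArr U f) A)))"

definition PreCPM ::
  "('g monoid \<Rightarrow> 'g list) \<Rightarrow> ('x, 'y, 'a, 'b) smc_universe
    \<Rightarrow> (('x, 'y, 'g, 'a, 'b) precpm, ('x, 'y, 'g, 'a, 'b) precpm_map, 'a, 'b) smc_universe" where
  "PreCPM ord U = \<lparr>
     Cat = \<lparr>Obj = {X. precpm_object ord U X}, Arr = {F. precpm_arrow ord U F},
       Dom = PDom, Cod = PCod,
       Idt = (\<lambda>X. \<lparr>PDom = X, PCod = X, PMap = Idt (Cat U) (Base X)\<rparr>),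
       Comp = (\<lambda>G F. \<lparr>PDom = PDom F, PCod = PCod G, PMap = PMap G \<cdot>\<^bsub>Cat U\<^esub> PMap F\<rparr>)\<rparr>,
     UObj = (\<lambda>X. UObj U (Base X)), UArr = (\<lambda>F. UArr U (PMap F))\<rparr>"

text \<open>
  The restriction of a morphism of PreCPM, for a subcategory of \<open>SMCs\<close>, to the associated CPM
  categories. It is always an arrow of \<open>SMCs\<close>, but it need not be one of \<open>\<Theta>\<close> if \<open>\<Theta>\<close> is not full.
  For example, let \<open>G\<close> be of order 2 and act trivially on the one-object SMC given by the additive
  monoid of pairs of natural numbers; its CPM category consists of the pairs of even numbers. The
  subcategory generated by the folding functor and the swap of components on the former does not
  contain the swap on the latter.
\<close>

definition cpm_restrict ::
  "('g monoid \<Rightarrow> 'g list) \<Rightarrow> (('a, 'b) smc, ('a, 'b) smf) category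
    \<Rightarrow> (('a, 'b) smc, ('a, 'b) smf, 'g, 'a, 'b) precpm_map \<Rightarrow> ('a, 'b) smf" where
  "cpm_restrict ord \<Theta> F =
    (let D = cpm_of ord (incl_universe \<Theta>) (PDom F); E = cpm_of ord (incl_universe \<Theta>) (PCod F) in
     \<lparr>SDom = D, SCod = E, OMap = restrict (OMap (PMap F)) (Obj D),
      AMap = restrict (AMap (PMap F)) (Arr D)\<rparr>)"

end

theory Submission
  imports Defs
begin

text \<open>
  An equivariant strict symmetric monoidal functor \<open>F\<close> commutes with everything out of which a CPM
  category is built. The permutations \<open>pi_iso\<close> are composites of structural isomorphisms, their
  inverses and tensor products, so \<open>F\<close> maps them to the corresponding permutations of its target
  (\<open>map_interleave\<close>, \<open>map_pi_iso\<close>); equivariance lets \<open>F\<close> pass through the factors of a folding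
  (\<open>map_fld_obj\<close>, \<open>map_fld_arr\<close>); and effects of the environment go to effects of the environment by
  assumption. Induction over the generation of the CPM category then shows that \<open>F\<close> restricts to CPM
  categories (\<open>map_cpm_arr\<close>), and the equation \<open>F (fld A) = fld (F A)\<close> is at once what makes the
  restriction strict monoidal (\<open>cpm_map_smf\<close>) and what makes the folding functors natural
  (\<open>cpm_map_natural\<close>). That the CPM categories are symmetric monoidal is part of being an object of
  PreCPM, so what remains is a comparison of two given structures. The restriction lies in \<open>\<Theta>\<close>
  because \<open>\<Theta>\<close> is assumed to contain the restrictions that are arrows of \<open>SMCs\<close>. Functoriality follows
  since restricting functors preserves identities and composites.

  That PreCPM is a category with a faithful functor to \<open>SMCs\<close> is routine. The delicate point is that
  the image of this functor is a subcategory: two arrows of the image that are composable as functors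
  may come from arrows of PreCPM that are not composable, because the group actions or the
  environments in the middle differ. In the strict case the image is nevertheless closed under
  composition, because it is all of \<open>\<Theta>\<close>. Every object of \<open>\<Theta>\<close> carries the action of a one-element
  group with the identity of the unit as its only effect (\<open>trivial_precpm\<close>); its CPM category is the
  original category itself and its folding functor is the identity (\<open>CPM_trivial\<close>, \<open>fld_trivial\<close>), so
  it is an object of PreCPM, and every arrow of \<open>\<Theta>\<close> is an arrow between these objects.
\<close>

section \<open>Isomorphisms and iterated tensor products\<close>

text \<open>
  The simplification rules of this section compute the domain, the codomain and the invertibility of
  composites and tensor products. With them, the side conditions in the later calculations with
  structural isomorphisms are discharged by rewriting.
\<close>

context category
begin

lemma arr_idt [simp]: "A \<in> Obj C \<Longrightarrow> Idt C A \<in> Arr C"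
  and dom_idt [simp]: "A \<in> Obj C \<Longrightarrow> Dom C (Idt C A) = A"
  and cod_idt [simp]: "A \<in> Obj C \<Longrightarrow> Cod C (Idt C A) = A"
  using idt_hom by (auto simp: Hom_def)

lemma arr_comp [simp]:
    "\<lbrakk>f \<in> Arr C; g \<in> Arr C; Dom C g = Cod C f\<rbrakk> \<Longrightarrow> g \<cdot> f \<in> Arr C"
  and dom_comp [simp]:
    "\<lbrakk>f \<in> Arr C; g \<in> Arr C; Dom C g = Cod C f\<rbrakk> \<Longrightarrow> Dom C (g \<cdot> f) = Dom C f"
  and cod_comp [simp]:
    "\<lbrakk>f \<in> Arr C; g \<in> Arr C; Dom C g = Cod C f\<rbrakk> \<Longrightarrow> Cod C (g \<cdot> f) = Cod C g"
  using comp_hom[of f "Dom C f" "Cod C f" g "Cod C g"] by (auto simp: Hom_def)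

lemma idt_comp [simp]: "\<lbrakk>f \<in> Arr C; Cod C f = B\<rbrakk> \<Longrightarrow> Idt C B \<cdot> f = f"
  and comp_idt [simp]: "\<lbrakk>f \<in> Arr C; Dom C f = A\<rbrakk> \<Longrightarrow> f \<cdot> Idt C A = f"
  using comp_idt_left[of f "Dom C f" B] comp_idt_right[of f A "Cod C f"] by (auto simp: Hom_def)

lemma assoc:
  "\<lbrakk>f \<in> Arr C; g \<in> Arr C; h \<in> Arr C; Dom C g = Cod C f; Dom C h = Cod C g\<rbrakk>
    \<Longrightarrow> (h \<cdot> g) \<cdot> f = h \<cdot> (g \<cdot> f)"
  using comp_assoc[of f "Dom C f" "Cod C f" g "Cod C g" h "Cod C h"] by (auto simp: Hom_def)

lemmas [simp] = dom_closed cod_closed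

lemma is_inverse_unique:
  assumes "is_inverse C f g" "is_inverse C f h"
  shows "g = h"
proof -
  have "g = (h \<cdot> f) \<cdot> g"
    using assms by (auto simp: is_inverse_def Hom_def)
  also have "\<dots> = h \<cdot> (f \<cdot> g)"
    using assms by (intro assoc) (auto simp: is_inverse_def Hom_def)
  also have "\<dots> = h"
    using assms by (auto simp: is_inverse_def Hom_def)
  finally show ?thesis .
qed

lemma inv_arr_eq: "is_inverse C f g \<Longrightarrow> inv_arr C f = g"
  unfolding inv_arr_def by (blast intro: is_inverse_unique)

lemma is_inverse_inv_arr: "is_iso C f \<Longrightarrow> is_inverse C f (inv_arr C f)"
  using inv_arr_eq by (auto simp: is_iso_def)

lemma arr_inv [simp]: "is_iso C f \<Longrightarrow> inv_arr C f \<in> Arr C"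
  and dom_inv [simp]: "is_iso C f \<Longrightarrow> Dom C (inv_arr C f) = Cod C f"
  and cod_inv [simp]: "is_iso C f \<Longrightarrow> Cod C (inv_arr C f) = Dom C f"
  and inv_comp [simp]: "is_iso C f \<Longrightarrow> inv_arr C f \<cdot> f = Idt C (Dom C f)"
  and comp_inv [simp]: "is_iso C f \<Longrightarrow> f \<cdot> inv_arr C f = Idt C (Cod C f)"
  and iso_arr: "is_iso C f \<Longrightarrow> f \<in> Arr C"
  using is_inverse_inv_arr[of f] by (auto simp: is_inverse_def Hom_def)

lemma iso_inv [simp]: "is_iso C f \<Longrightarrow> is_iso C (inv_arr C f)"
  unfolding is_iso_def[of C "inv_arr C f"] is_inverse_def
  by (rule exI[of _ f]) (simp add: Hom_def iso_arr)

lemma is_inverse_idt: "A \<in> Obj C \<Longrightarrow> is_inverse C (Idt C A) (Idt C A)"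
  by (simp add: is_inverse_def Hom_def)

lemma iso_idt [simp]: "A \<in> Obj C \<Longrightarrow> is_iso C (Idt C A)"
  using is_inverse_idt by (auto simp: is_iso_def)

lemma inv_idt [simp]: "A \<in> Obj C \<Longrightarrow> inv_arr C (Idt C A) = Idt C A"
  by (rule inv_arr_eq[OF is_inverse_idt])

lemma iso_comp [simp]:
  assumes f: "is_iso C f" and g: "is_iso C g" and gf: "Dom C g = Cod C f"
  shows "is_iso C (g \<cdot> f)"
proof -
  note [simp] = iso_arr[OF f] iso_arr[OF g] f g gf
  let ?f' = "inv_arr C f" and ?g' = "inv_arr C g"
  have "(?f' \<cdot> ?g') \<cdot> (g \<cdot> f) = ?f' \<cdot> ((?g' \<cdot> g) \<cdot> f)"
    by (simp only: assoc[of f g ?g'] assoc[of "g \<cdot> f" ?g' ?f']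
        f g gf arr_comp cod_comp dom_comp arr_inv dom_inv cod_inv iso_arr)
  moreover have "(g \<cdot> f) \<cdot> (?f' \<cdot> ?g') = g \<cdot> ((f \<cdot> ?f') \<cdot> ?g')"
    by (simp only: assoc[of ?g' ?f' f] assoc[of "?f' \<cdot> ?g'" f g]
        f g gf arr_comp cod_comp dom_comp arr_inv dom_inv cod_inv iso_arr)
  ultimately have "is_inverse C (g \<cdot> f) (?f' \<cdot> ?g')"
    by (simp add: is_inverse_def Hom_def)
  then show ?thesis
    by (auto simp: is_iso_def)
qed

end

context smc
begin

lemmas [simp] = unit_closed tobj_closed

lemma arr_tarr [simp]: "\<lbrakk>f \<in> Arr C; g \<in> Arr C\<rbrakk> \<Longrightarrow> f \<otimes>\<^sub>a g \<in> Arr C"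
  and dom_tarr [simp]:
    "\<lbrakk>f \<in> Arr C; g \<in> Arr C\<rbrakk> \<Longrightarrow> Dom C (f \<otimes>\<^sub>a g) = Dom C f \<otimes>\<^sub>o Dom C g"
  and cod_tarr [simp]:
    "\<lbrakk>f \<in> Arr C; g \<in> Arr C\<rbrakk> \<Longrightarrow> Cod C (f \<otimes>\<^sub>a g) = Cod C f \<otimes>\<^sub>o Cod C g"
  using tarr_hom[of f "Dom C f" "Cod C f" g "Dom C g" "Cod C g"] by (auto simp: Hom_def)

lemma iso_tarr [simp]:
  assumes f: "is_iso C f" and g: "is_iso C g"
  shows "is_iso C (f \<otimes>\<^sub>a g)"
proof -
  note [simp] = iso_arr[OF f] iso_arr[OF g]
  have "is_inverse C (f \<otimes>\<^sub>a g) (inv_arr C f \<otimes>\<^sub>a inv_arr C g)"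
    using f g
      interchange[of f "Dom C f" "Cod C f" "inv_arr C f" "Dom C f"
        g "Dom C g" "Cod C g" "inv_arr C g" "Dom C g"]
      interchange[of "inv_arr C f" "Cod C f" "Dom C f" f "Cod C f"
        "inv_arr C g" "Cod C g" "Dom C g" g "Cod C g"]
    by (simp add: is_inverse_def Hom_def tarr_idt)
  then show ?thesis
    by (auto simp: is_iso_def)
qed

lemma arr_asc [simp]:
    "\<lbrakk>X \<in> Obj C; Y \<in> Obj C; Z \<in> Obj C\<rbrakk> \<Longrightarrow> Asc C X Y Z \<in> Arr C"
  and dom_asc [simp]:
    "\<lbrakk>X \<in> Obj C; Y \<in> Obj C; Z \<in> Obj C\<rbrakk> \<Longrightarrow> Dom C (Asc C X Y Z) = (X \<otimes>\<^sub>o Y) \<otimes>\<^sub>o Z"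
  and cod_asc [simp]:
    "\<lbrakk>X \<in> Obj C; Y \<in> Obj C; Z \<in> Obj C\<rbrakk> \<Longrightarrow> Cod C (Asc C X Y Z) = X \<otimes>\<^sub>o (Y \<otimes>\<^sub>o Z)"
  using asc_hom by (auto simp: Hom_def)

lemma arr_sym [simp]: "\<lbrakk>X \<in> Obj C; Y \<in> Obj C\<rbrakk> \<Longrightarrow> Sym C X Y \<in> Arr C"
  and dom_sym [simp]: "\<lbrakk>X \<in> Obj C; Y \<in> Obj C\<rbrakk> \<Longrightarrow> Dom C (Sym C X Y) = X \<otimes>\<^sub>o Y"
  and cod_sym [simp]: "\<lbrakk>X \<in> Obj C; Y \<in> Obj C\<rbrakk> \<Longrightarrow> Cod C (Sym C X Y) = Y \<otimes>\<^sub>o X"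
  using sym_hom by (auto simp: Hom_def)

lemma arr_lun [simp]: "X \<in> Obj C \<Longrightarrow> Lun C X \<in> Arr C"
  and dom_lun [simp]: "X \<in> Obj C \<Longrightarrow> Dom C (Lun C X) = Unit C \<otimes>\<^sub>o X"
  and cod_lun [simp]: "X \<in> Obj C \<Longrightarrow> Cod C (Lun C X) = X"
  using lun_hom by (auto simp: Hom_def)

lemma arr_run [simp]: "X \<in> Obj C \<Longrightarrow> Run C X \<in> Arr C"
  using run_hom by (auto simp: Hom_def)

lemmas [simp] = asc_iso lun_iso

lemma iso_sym [simp]: "\<lbrakk>X \<in> Obj C; Y \<in> Obj C\<rbrakk> \<Longrightarrow> is_iso C (Sym C X Y)"
  unfolding is_iso_def is_inverse_def
  by (rule exI[of _ "Sym C Y X"]) (simp add: Hom_def sym_sym)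

lemma tens_obj_closed [simp]: "set As \<subseteq> Obj C \<Longrightarrow> tens_obj C As \<in> Obj C"
  by (induction As rule: induct_list012) auto

lemma tens_arr_type:
  "set fs \<subseteq> Arr C \<Longrightarrow> tens_arr C fs \<in> Arr C
    \<and> Dom C (tens_arr C fs) = tens_obj C (map (Dom C) fs)
    \<and> Cod C (tens_arr C fs) = tens_obj C (map (Cod C) fs)"
  by (induction fs rule: induct_list012) auto

lemma mid4_type:
  assumes "A \<in> Obj C" "X \<in> Obj C" "B \<in> Obj C" "Y \<in> Obj C"
  shows iso_mid4 [simp]: "is_iso C (mid4 C A X B Y)"
    and arr_mid4 [simp]: "mid4 C A X B Y \<in> Arr C"
    and dom_mid4 [simp]: "Dom C (mid4 C A X B Y) = (A \<otimes>\<^sub>o X) \<otimes>\<^sub>o (B \<otimes>\<^sub>o Y)"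
    and cod_mid4 [simp]: "Cod C (mid4 C A X B Y) = (A \<otimes>\<^sub>o B) \<otimes>\<^sub>o (X \<otimes>\<^sub>o Y)"
  using assms unfolding mid4_def by simp_all

lemma tens_obj_pairs_closed:
  assumes "set ps \<subseteq> Obj C \<times> Obj C"
  shows "tens_obj C (map fst ps) \<in> Obj C" "tens_obj C (map snd ps) \<in> Obj C"
proof -
  have "fst p \<in> Obj C \<and> snd p \<in> Obj C" if "p \<in> set ps" for p
    using assms that by (auto simp: mem_Times_iff dest: subsetD)
  then show "tens_obj C (map fst ps) \<in> Obj C" "tens_obj C (map snd ps) \<in> Obj C"
    by (auto intro!: tens_obj_closed)
qed

text \<open>
  Invertibility is proved together with the typing because functors preserve the inverse of an arrow
  only if that inverse exists; \<^const>\<open>inv_arr\<close> is a definite description.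
\<close>

lemma interleave_type:
  "set ps \<subseteq> Obj C \<times> Obj C \<Longrightarrow> is_iso C (interleave C ps)
    \<and> interleave C ps \<in> Arr C
    \<and> Dom C (interleave C ps) = tens_obj C (map fst ps) \<otimes>\<^sub>o tens_obj C (map snd ps)
    \<and> Cod C (interleave C ps) = tens_obj C (map (\<lambda>(A, B). A \<otimes>\<^sub>o B) ps)"
proof (induction ps rule: induct_list012)
  case (3 p q ps)
  obtain A B where p: "p = (A, B)" by force
  have "tens_obj C (map fst (q # ps)) \<in> Obj C" "tens_obj C (map snd (q # ps)) \<in> Obj C"
    using "3.prems" tens_obj_pairs_closed[of "q # ps"] by simp_all
  moreover have "is_iso C (interleave C (q # ps))" "interleave C (q # ps) \<in> Arr C"
    "Dom C (interleave C (q # ps))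
      = tens_obj C (map fst (q # ps)) \<otimes>\<^sub>o tens_obj C (map snd (q # ps))"
    "Cod C (interleave C (q # ps)) = tens_obj C (map (\<lambda>(A, B). A \<otimes>\<^sub>o B) (q # ps))"
    using "3.IH"(2) "3.prems" by auto
  ultimately show ?case
    using "3.prems" unfolding p by simp
qed auto

end


section \<open>Symmetric monoidal functors\<close>

lemma Hom_SMCs: "F \<in> Hom SMCs C D \<longleftrightarrow> is_smf F \<and> SDom F = C \<and> SCod F = D"
  by (auto simp: Hom_def SMCs_def)

lemma SMCs_simps [simp]:
  "Obj SMCs = {C. smc C}" "Arr SMCs = {F. is_smf F}" "Dom SMCs = SDom" "Cod SMCs = SCod"
  "Idt SMCs = smf_id" "Comp SMCs = smf_comp"
  by (simp_all add: SMCs_def)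

locale smf_between = C: smc C + D: smc D for C D :: "('a, 'b) smc" +
  fixes F :: "('a, 'b) smf"
  assumes F_hom: "F \<in> Hom SMCs C D"
begin

lemma map_obj [simp]: "A \<in> Obj C \<Longrightarrow> OMap F A \<in> Obj D"
  and map_arr [simp]: "f \<in> Arr C \<Longrightarrow> AMap F f \<in> Arr D"
  and map_dom [simp]: "f \<in> Arr C \<Longrightarrow> Dom D (AMap F f) = OMap F (Dom C f)"
  and map_cod [simp]: "f \<in> Arr C \<Longrightarrow> Cod D (AMap F f) = OMap F (Cod C f)"
  and map_idt [simp]: "A \<in> Obj C \<Longrightarrow> AMap F (Idt C A) = Idt D (OMap F A)"
  and map_comp [simp]: "\<lbrakk>f \<in> Arr C; g \<in> Arr C; Dom C g = Cod C f\<rbrakk>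
    \<Longrightarrow> AMap F (g \<cdot>\<^bsub>C\<^esub> f) = AMap F g \<cdot>\<^bsub>D\<^esub> AMap F f"
  and map_unit [simp]: "OMap F (Unit C) = Unit D"
  and map_tobj [simp]:
    "\<lbrakk>A \<in> Obj C; B \<in> Obj C\<rbrakk> \<Longrightarrow> OMap F (A \<otimes>\<^sub>o\<^bsub>C\<^esub> B) = OMap F A \<otimes>\<^sub>o\<^bsub>D\<^esub> OMap F B"
  and map_tarr [simp]:
    "\<lbrakk>f \<in> Arr C; g \<in> Arr C\<rbrakk> \<Longrightarrow> AMap F (f \<otimes>\<^sub>a\<^bsub>C\<^esub> g) = AMap F f \<otimes>\<^sub>a\<^bsub>D\<^esub> AMap F g"
  and map_asc [simp]: "\<lbrakk>A \<in> Obj C; B \<in> Obj C; E \<in> Obj C\<rbrakk>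
    \<Longrightarrow> AMap F (Asc C A B E) = Asc D (OMap F A) (OMap F B) (OMap F E)"
  and map_lun [simp]: "A \<in> Obj C \<Longrightarrow> AMap F (Lun C A) = Lun D (OMap F A)"
  and map_run [simp]: "A \<in> Obj C \<Longrightarrow> AMap F (Run C A) = Run D (OMap F A)"
  and map_sym [simp]:
    "\<lbrakk>A \<in> Obj C; B \<in> Obj C\<rbrakk> \<Longrightarrow> AMap F (Sym C A B) = Sym D (OMap F A) (OMap F B)"
  using F_hom by (auto simp: Hom_SMCs is_smf_def is_functor_def Let_def Hom_def)

lemma map_is_inverse:
  "is_inverse C f g \<Longrightarrow> is_inverse D (AMap F f) (AMap F g)"
  unfolding is_inverse_def by (auto simp: Hom_def map_comp[symmetric] simp del: map_comp)

text \<open>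
  A functor preserves the defining equations of inverses, and inverses are unique.
\<close>

lemma map_inv [simp]: "is_iso C f \<Longrightarrow> AMap F (inv_arr C f) = inv_arr D (AMap F f)"
  using D.inv_arr_eq[OF map_is_inverse[OF C.is_inverse_inv_arr]] by simp

lemma map_iso [simp]: "is_iso C f \<Longrightarrow> is_iso D (AMap F f)"
  using map_is_inverse by (auto simp: is_iso_def)

lemma map_tens_obj:
  "set As \<subseteq> Obj C \<Longrightarrow> OMap F (tens_obj C As) = tens_obj D (map (OMap F) As)"
  by (induction As rule: induct_list012) auto

lemma map_tens_arr:
  "set fs \<subseteq> Arr C \<Longrightarrow> AMap F (tens_arr C fs) = tens_arr D (map (AMap F) fs)"
  by (induction fs rule: induct_list012) (auto simp: C.tens_arr_type)

lemma map_mid4: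
  "\<lbrakk>A \<in> Obj C; X \<in> Obj C; B \<in> Obj C; Y \<in> Obj C\<rbrakk>
    \<Longrightarrow> AMap F (mid4 C A X B Y) = mid4 D (OMap F A) (OMap F X) (OMap F B) (OMap F Y)"
  by (simp add: mid4_def)

text \<open>
  Each permutation is built recursively from \<^const>\<open>mid4\<close>, itself a composite of associators and
  symmetries. A strict functor preserves these on the nose.
\<close>

lemma map_interleave:
  "set ps \<subseteq> Obj C \<times> Obj C
    \<Longrightarrow> AMap F (interleave C ps) = interleave D (map (map_prod (OMap F) (OMap F)) ps)"
proof (induction ps rule: induct_list012)
  case (3 p q ps)
  obtain A B where p: "p = (A, B)" by force
  let ?X = "tens_obj C (map fst (q # ps))" and ?Y = "tens_obj C (map snd (q # ps))"
  have sub: "set (map fst (q # ps)) \<subseteq> Obj C" "set (map snd (q # ps)) \<subseteq> Obj C"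
    using "3.prems" by auto
  then have XY: "?X \<in> Obj C" "?Y \<in> Obj C"
    by (simp_all only: C.tens_obj_closed)
  have FXY: "OMap F ?X = tens_obj D (map (OMap F) (map fst (q # ps)))"
    "OMap F ?Y = tens_obj D (map (OMap F) (map snd (q # ps)))"
    using sub by (simp_all only: map_tens_obj)
  have "set (q # ps) \<subseteq> Obj C \<times> Obj C"
    using "3.prems" by simp
  note type = C.interleave_type[OF this] and IH = "3.IH"(2)[OF this]
  have "AMap F (interleave C (p # q # ps))
      = (Idt D (OMap F A \<otimes>\<^sub>o\<^bsub>D\<^esub> OMap F B) \<otimes>\<^sub>a\<^bsub>D\<^esub> AMap F (interleave C (q # ps)))
        \<cdot>\<^bsub>D\<^esub> mid4 D (OMap F A) (OMap F ?X) (OMap F B) (OMap F ?Y)"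
    using "3.prems" XY type unfolding p by (simp add: map_mid4 del: list.map)
  then show ?case
    unfolding p IH FXY by (simp add: comp_def)
qed (auto simp: map_prod_def)

end

lemma smf_betweenI: "F \<in> Hom SMCs C D \<Longrightarrow> smf_between C D F"
  by (auto simp: smf_between_def smf_between_axioms_def Hom_SMCs is_smf_def Let_def)


section \<open>Folding and the CPM category\<close>

locale smc_action = smc C for C :: "('a, 'b) smc" (structure) +
  fixes gs :: "'g list" and \<Psi> :: "'g \<Rightarrow> ('a, 'b) smf"
  assumes acts: "\<gamma> \<in> set gs \<Longrightarrow> \<Psi> \<gamma> \<in> Hom SMCs C C"
begin

lemma act_smf: "\<gamma> \<in> set gs \<Longrightarrow> smf_between C C (\<Psi> \<gamma>)"
  by (intro smf_betweenI acts)

lemma act_type: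
  assumes "\<gamma> \<in> set gs"
  shows "A \<in> Obj C \<Longrightarrow> OMap (\<Psi> \<gamma>) A \<in> Obj C"
    and "f \<in> Arr C \<Longrightarrow> AMap (\<Psi> \<gamma>) f \<in> Arr C"
    and "f \<in> Arr C \<Longrightarrow> Dom C (AMap (\<Psi> \<gamma>) f) = OMap (\<Psi> \<gamma>) (Dom C f)"
    and "f \<in> Arr C \<Longrightarrow> Cod C (AMap (\<Psi> \<gamma>) f) = OMap (\<Psi> \<gamma>) (Cod C f)"
  using smf_between.map_obj[OF act_smf] smf_between.map_arr[OF act_smf]
    smf_between.map_dom[OF act_smf] smf_between.map_cod[OF act_smf] assms by auto

lemma fld_obj_closed [simp]: "A \<in> Obj C \<Longrightarrow> fld_obj C gs \<Psi> A \<in> Obj C"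
  unfolding fld_obj_def by (rule tens_obj_closed) (auto simp: act_type)

lemma arr_fld [simp]: "f \<in> Arr C \<Longrightarrow> fld_arr C gs \<Psi> f \<in> Arr C"
  and dom_fld [simp]:
    "f \<in> Arr C \<Longrightarrow> Dom C (fld_arr C gs \<Psi> f) = fld_obj C gs \<Psi> (Dom C f)"
  and cod_fld [simp]:
    "f \<in> Arr C \<Longrightarrow> Cod C (fld_arr C gs \<Psi> f) = fld_obj C gs \<Psi> (Cod C f)"
  using tens_arr_type[of "map (\<lambda>\<gamma>. AMap (\<Psi> \<gamma>) f) gs"]
  by (auto simp: fld_obj_def fld_arr_def act_type image_subset_iff comp_def cong: map_cong)

lemma pi_iso_type:
  assumes "A \<in> Obj C" "B \<in> Obj C"
  shows iso_pi [simp]: "is_iso C (pi_iso C gs \<Psi> A B)"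
    and arr_pi [simp]: "pi_iso C gs \<Psi> A B \<in> Arr C"
    and dom_pi [simp]: "Dom C (pi_iso C gs \<Psi> A B) = fld_obj C gs \<Psi> A \<otimes>\<^sub>o fld_obj C gs \<Psi> B"
    and cod_pi [simp]: "Cod C (pi_iso C gs \<Psi> A B) = fld_obj C gs \<Psi> (A \<otimes>\<^sub>o B)"
proof -
  have "set (map (\<lambda>\<gamma>. (OMap (\<Psi> \<gamma>) A, OMap (\<Psi> \<gamma>) B)) gs) \<subseteq> Obj C \<times> Obj C"
    using assms by (auto simp: act_type)
  from interleave_type[OF this]
  show "is_iso C (pi_iso C gs \<Psi> A B)" "pi_iso C gs \<Psi> A B \<in> Arr C"
    "Dom C (pi_iso C gs \<Psi> A B) = fld_obj C gs \<Psi> A \<otimes>\<^sub>o fld_obj C gs \<Psi> B"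
    "Cod C (pi_iso C gs \<Psi> A B) = fld_obj C gs \<Psi> (A \<otimes>\<^sub>o B)"
    using assms
    by (auto simp: pi_iso_def fld_obj_def comp_def smf_between.map_tobj[OF act_smf]
        cong: map_cong)
qed

end

lemma CPM_sel:
  "Obj (CPM C gs \<Psi> \<Xi>) = fld_obj C gs \<Psi> ` Obj C"
  "Arr (CPM C gs \<Psi> \<Xi>) = cpm_arr C gs \<Psi> \<Xi>"
  "Unit (CPM C gs \<Psi> \<Xi>) = fld_obj C gs \<Psi> (Unit C)"
  by (simp_all add: CPM_def Let_def)

text \<open>
  The data of an object of PreCPM from which the properties of the CPM functor follow. Injectivity on
  objects makes the tensor product of the CPM category computable: it recovers \<open>A\<close> from
  \<open>fld_obj C gs \<Psi> A\<close>.
\<close>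

locale cpm_data = smc_action C gs \<Psi> for C :: "('a, 'b) smc" (structure) and gs :: "'g list" and \<Psi> +
  fixes \<Xi> :: "'a \<Rightarrow> 'b set"
  assumes effects: "A \<in> Obj C \<Longrightarrow> \<Xi> A \<subseteq> Hom C (fld_obj C gs \<Psi> A) (Unit C)"
    and inj: "inj_on (fld_obj C gs \<Psi>) (Obj C)"
    and cpm_smc: "smc (CPM C gs \<Psi> \<Xi>)"
begin

abbreviation "fo \<equiv> fld_obj C gs \<Psi>"
abbreviation "fa \<equiv> fld_arr C gs \<Psi>"
abbreviation "M \<equiv> cpm_arr C gs \<Psi> \<Xi>"
abbreviation "K \<equiv> CPM C gs \<Psi> \<Xi>"

lemma effect_type:
  assumes "A \<in> Obj C" "\<xi> \<in> \<Xi> A"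
  shows "\<xi> \<in> Arr C" "Dom C \<xi> = fo A" "Cod C \<xi> = Unit C"
  using effects assms by (auto simp: Hom_def)

lemma cpm_arr_type:
  assumes "f \<in> M"
  shows "f \<in> Arr C" "\<exists>A\<in>Obj C. Dom C f = fo A" "\<exists>B\<in>Obj C. Cod C f = fo B"
proof -
  have "f \<in> Arr C \<and> (\<exists>A\<in>Obj C. Dom C f = fo A) \<and> (\<exists>B\<in>Obj C. Cod C f = fo B)"
    using assms
  proof induction
    case (fold f)
    then show ?case by auto
  next
    case (discard A B \<xi>)
    then show ?case by (auto simp: effect_type)
  qed auto
  then show "f \<in> Arr C" "\<exists>A\<in>Obj C. Dom C f = fo A" "\<exists>B\<in>Obj C. Cod C f = fo B"
    by auto
qed

lemma cpm_arr_cases: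
  assumes "f \<in> M"
  obtains A B where "A \<in> Obj C" "B \<in> Obj C" "f \<in> Arr C" "Dom C f = fo A" "Cod C f = fo B"
  using cpm_arr_type[OF assms] by auto

lemma CPM_cat_simps [simp]:
  "f \<in> M \<Longrightarrow> Dom K f = Dom C f"
  "f \<in> M \<Longrightarrow> Cod K f = Cod C f"
  "A \<in> Obj C \<Longrightarrow> Idt K (fo A) = Idt C (fo A)"
  "\<lbrakk>f \<in> M; g \<in> M; Dom C g = Cod C f\<rbrakk> \<Longrightarrow> g \<cdot>\<^bsub>K\<^esub> f = g \<cdot> f"
  by (simp_all add: CPM_def Let_def)

lemma CPM_monoidal_simps [simp]:
  "\<lbrakk>A \<in> Obj C; B \<in> Obj C\<rbrakk> \<Longrightarrow> fo A \<otimes>\<^sub>o\<^bsub>K\<^esub> fo B = fo (A \<otimes>\<^sub>o B)"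
  "\<lbrakk>A \<in> Obj C; B \<in> Obj C; E \<in> Obj C\<rbrakk> \<Longrightarrow> Asc K (fo A) (fo B) (fo E) = fa (Asc C A B E)"
  "A \<in> Obj C \<Longrightarrow> Lun K (fo A) = fa (Lun C A)"
  "A \<in> Obj C \<Longrightarrow> Run K (fo A) = fa (Run C A)"
  "\<lbrakk>A \<in> Obj C; B \<in> Obj C\<rbrakk> \<Longrightarrow> Sym K (fo A) (fo B) = fa (Sym C A B)"
  by (simp_all add: CPM_def Let_def inv_into_f_f[OF inj])

lemma CPM_tarr:
  assumes "f \<in> M" "Dom C f = fo A" "Cod C f = fo B" "A \<in> Obj C" "B \<in> Obj C"
    and "h \<in> M" "Dom C h = fo A'" "Cod C h = fo B'" "A' \<in> Obj C" "B' \<in> Obj C"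
  shows "f \<otimes>\<^sub>a\<^bsub>K\<^esub> h
    = pi_iso C gs \<Psi> B B' \<cdot> (f \<otimes>\<^sub>a h) \<cdot> inv_arr C (pi_iso C gs \<Psi> A A')"
  using assms by (simp add: CPM_def Let_def inv_into_f_f[OF inj])

end

locale equivariant_smf =
  smf_between C D F + C: cpm_data C gs \<Psi> \<Xi> + D: cpm_data D gs \<Phi> \<Upsilon>
  for C D :: "('a, 'b) smc" and F and gs :: "'g list" and \<Psi> \<Xi> \<Phi> \<Upsilon> +
  assumes equivariant: "\<gamma> \<in> set gs \<Longrightarrow> smf_comp F (\<Psi> \<gamma>) = smf_comp (\<Phi> \<gamma>) F"
    and respects: "\<lbrakk>A \<in> Obj C; \<xi> \<in> \<Xi> A\<rbrakk> \<Longrightarrow> AMap F \<xi> \<in> \<Upsilon> (OMap F A)"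
begin

text \<open>
  Composites of functors are extensional functions, so equality of composites says something only
  about values at objects, respectively arrows, of the source category.
\<close>

lemma equivariant_obj:
  assumes "\<gamma> \<in> set gs" "A \<in> Obj C"
  shows "OMap F (OMap (\<Psi> \<gamma>) A) = OMap (\<Phi> \<gamma>) (OMap F A)"
proof -
  have "OMap (smf_comp F (\<Psi> \<gamma>)) A = OMap (smf_comp (\<Phi> \<gamma>) F) A"
    using assms equivariant by simp
  then show ?thesis
    using assms F_hom C.acts by (simp add: smf_comp_def compose_def Hom_SMCs)
qed

lemma equivariant_arr:
  assumes "\<gamma> \<in> set gs" "f \<in> Arr C"
  shows "AMap F (AMap (\<Psi> \<gamma>) f) = AMap (\<Phi> \<gamma>) (AMap F f)"
proof -
  have "AMap (smf_comp F (\<Psi> \<gamma>)) f = AMap (smf_comp (\<Phi> \<gamma>) F) f"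
    using assms equivariant by simp
  then show ?thesis
    using assms F_hom C.acts by (simp add: smf_comp_def compose_def Hom_SMCs)
qed

lemma map_fld_obj [simp]: "A \<in> Obj C \<Longrightarrow> OMap F (C.fo A) = D.fo (OMap F A)"
  unfolding fld_obj_def
  by (subst map_tens_obj) (auto simp: C.act_type equivariant_obj comp_def cong: map_cong)

lemma map_fld_arr [simp]: "f \<in> Arr C \<Longrightarrow> AMap F (C.fa f) = D.fa (AMap F f)"
  unfolding fld_arr_def
  by (subst map_tens_arr) (auto simp: C.act_type equivariant_arr comp_def cong: map_cong)

lemma map_pi_iso [simp]:
  "\<lbrakk>A \<in> Obj C; B \<in> Obj C\<rbrakk>
    \<Longrightarrow> AMap F (pi_iso C gs \<Psi> A B) = pi_iso D gs \<Phi> (OMap F A) (OMap F B)"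
  unfolding pi_iso_def
  by (subst map_interleave) (auto simp: C.act_type equivariant_obj comp_def cong: map_cong)

text \<open>
  The images of the generators are generators: a folding goes to a folding by equivariance, and the
  discarding map of an effect goes to the discarding map of its image, which is again an effect of
  the environment.
\<close>

lemma map_cpm_arr: "f \<in> C.M \<Longrightarrow> AMap F f \<in> D.M"
proof (induction rule: cpm_arr.induct)
  case (fold f)
  then show ?case by (simp add: cpm_arr.fold)
next
  case (discard A B \<xi>)
  then show ?case
    using cpm_arr.discard[of "OMap F A" D "OMap F B" "AMap F \<xi>" \<Upsilon> gs \<Phi>]
    by (simp add: C.effect_type respects)
next
  case (idt A)
  then show ?case by (simp add: cpm_arr.idt)
next
  case (comp f g)
  then show ?case by (simp add: cpm_arr.comp C.cpm_arr_type)
qed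

definition cpm_map :: "('a, 'b) smf" where
  "cpm_map = \<lparr>SDom = C.K, SCod = D.K,
     OMap = restrict (OMap F) (Obj C.K), AMap = restrict (AMap F) (Arr C.K)\<rparr>"

text \<open>
  The tensor product of the CPM category conjugates that of the underlying category by permutations,
  so it is preserved because both of these are.
\<close>

lemma cpm_map_tarr:
  assumes f: "f \<in> C.M" and h: "h \<in> C.M"
  shows "AMap F (f \<otimes>\<^sub>a\<^bsub>C.K\<^esub> h) = AMap F f \<otimes>\<^sub>a\<^bsub>D.K\<^esub> AMap F h"
proof -
  obtain A B where A: "A \<in> Obj C" "B \<in> Obj C" "f \<in> Arr C" "Dom C f = C.fo A" "Cod C f = C.fo B"
    using f by (rule C.cpm_arr_cases)
  obtain A' B' where A':
    "A' \<in> Obj C" "B' \<in> Obj C" "h \<in> Arr C" "Dom C h = C.fo A'" "Cod C h = C.fo B'"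
    using h by (rule C.cpm_arr_cases)
  have "f \<otimes>\<^sub>a\<^bsub>C.K\<^esub> h
      = pi_iso C gs \<Psi> B B' \<cdot>\<^bsub>C\<^esub> (f \<otimes>\<^sub>a\<^bsub>C\<^esub> h) \<cdot>\<^bsub>C\<^esub> inv_arr C (pi_iso C gs \<Psi> A A')"
    using A A' f h by (intro C.CPM_tarr) auto
  moreover have "AMap F f \<otimes>\<^sub>a\<^bsub>D.K\<^esub> AMap F h
      = pi_iso D gs \<Phi> (OMap F B) (OMap F B') \<cdot>\<^bsub>D\<^esub> (AMap F f \<otimes>\<^sub>a\<^bsub>D\<^esub> AMap F h)
        \<cdot>\<^bsub>D\<^esub> inv_arr D (pi_iso D gs \<Phi> (OMap F A) (OMap F A'))"
    using A A' f h by (intro D.CPM_tarr) (auto simp: map_cpm_arr)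
  ultimately show ?thesis
    using A A' by simp
qed

lemma cpm_map_obj [simp]: "A \<in> Obj C \<Longrightarrow> OMap cpm_map (C.fo A) = D.fo (OMap F A)"
  by (simp add: cpm_map_def CPM_sel)

lemma cpm_map_arr [simp]: "f \<in> C.M \<Longrightarrow> AMap cpm_map f = AMap F f"
  by (simp add: cpm_map_def CPM_sel)

lemma cpm_map_functor: "is_functor C.K D.K (OMap cpm_map) (AMap cpm_map)"
  unfolding is_functor_def CPM_sel
proof (intro conjI ballI impI, goal_cases)
  case 1
  show ?case using C.cpm_smc by (simp add: smc_def)
next
  case 2
  show ?case using D.cpm_smc by (simp add: smc_def)
next
  case (4 f)
  obtain A B where "A \<in> Obj C" "B \<in> Obj C" "f \<in> Arr C" "Dom C f = C.fo A" "Cod C f = C.fo B"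
    using 4 by (rule C.cpm_arr_cases)
  with 4 show ?case
    by (simp add: Hom_def CPM_sel map_cpm_arr)
next
  case (5 X)
  then show ?case by (auto simp: cpm_arr.idt)
next
  case (6 f g)
  then show ?case by (simp add: C.cpm_arr_type map_cpm_arr cpm_arr.comp)
qed auto

lemma cpm_map_smf: "is_smf cpm_map"
proof -
  interpret CK: smc C.K by (rule C.cpm_smc)
  have tarr: "AMap cpm_map (f \<otimes>\<^sub>a\<^bsub>C.K\<^esub> h) = AMap cpm_map f \<otimes>\<^sub>a\<^bsub>D.K\<^esub> AMap cpm_map h"
    if "f \<in> C.M" "h \<in> C.M" for f h
    using that CK.arr_tarr[of f h] by (simp add: cpm_map_tarr CPM_sel)
  have "SDom cpm_map = C.K" "SCod cpm_map = D.K"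
    "OMap cpm_map \<in> extensional (Obj C.K)" "AMap cpm_map \<in> extensional (Arr C.K)"
    by (simp_all add: cpm_map_def)
  then show ?thesis
    using C.cpm_smc D.cpm_smc cpm_map_functor
    by (auto simp: is_smf_def CPM_sel cpm_arr.fold tarr)
qed

text \<open>
  Naturality of the folding functors is the equation of \<open>map_fld_obj\<close> and \<open>map_fld_arr\<close>, read as an
  equality of composite functors.
\<close>

lemma cpm_map_natural: "smf_comp (fld D gs \<Phi> \<Upsilon>) F = smf_comp cpm_map (fld C gs \<Psi> \<Xi>)"
proof -
  have "SDom F = C" "SCod F = D" "SDom cpm_map = C.K" "SCod cpm_map = D.K"
    using F_hom by (simp_all add: Hom_SMCs cpm_map_def)
  then show ?thesis
    by (simp add: smf_comp_def fld_def compose_def cpm_arr.fold cong: restrict_cong)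
qed

end


section \<open>The SMC-universe PreCPM\<close>

lemma smf_idt:
  assumes "smc C"
  shows "is_smf (smf_id C)"
proof -
  interpret smc C by fact
  have "category C" by unfold_locales
  then show ?thesis
    using assms by (auto simp: is_smf_def smf_id_def is_functor_def Hom_def)
qed

lemma precpm_objectD:
  assumes "precpm_object ord U X"
  shows "Base X \<in> Obj (Cat U)" "finite (carrier (Grp X))"
    "\<gamma> \<in> carrier (Grp X) \<Longrightarrow> Act X \<gamma> \<in> Hom (Cat U) (Base X) (Base X)"
    "A \<in> Obj (UObj U (Base X)) \<Longrightarrow>
       Env X A \<subseteq> Hom (UObj U (Base X)) (fld_obj_of ord U X A) (Unit (UObj U (Base X)))"
    "cpm_of ord U X \<in> UObj U ` Obj (Cat U)"
    "fld_of ord U X \<in> UArr U ` Arr (Cat U)"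
    "inj_on (fld_obj_of ord U X) (Obj (UObj U (Base X)))"
  using assms
  by (auto simp: precpm_object_def Let_def comm_group_def multi_environment_def fld_obj_of_def
      hom_def Aut_def)

lemma precpm_arrowI:
  assumes "precpm_object ord U X" "precpm_object ord U Y" "Grp X = Grp Y"
    "f \<in> Hom (Cat U) (Base X) (Base Y)"
    "\<And>\<gamma>. \<gamma> \<in> carrier (Grp X) \<Longrightarrow> f \<cdot>\<^bsub>Cat U\<^esub> Act X \<gamma> = Act Y \<gamma> \<cdot>\<^bsub>Cat U\<^esub> f"
    "\<And>A. A \<in> Obj (UObj U (Base X)) \<Longrightarrow> AMap (UArr U f) ` Env X A \<subseteq> Env Y (OMap (UArr U f) A)"
  shows "precpm_arrow ord U \<lparr>PDom = X, PCod = Y, PMap = f\<rparr>"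
  using assms by (simp add: precpm_arrow_def Let_def)

lemma precpm_arrowD:
  assumes "precpm_arrow ord U F"
  shows "precpm_object ord U (PDom F)" "precpm_object ord U (PCod F)" "Grp (PCod F) = Grp (PDom F)"
    "PMap F \<in> Hom (Cat U) (Base (PDom F)) (Base (PCod F))"
    "\<gamma> \<in> carrier (Grp (PDom F)) \<Longrightarrow>
       PMap F \<cdot>\<^bsub>Cat U\<^esub> Act (PDom F) \<gamma> = Act (PCod F) \<gamma> \<cdot>\<^bsub>Cat U\<^esub> PMap F"
    "A \<in> Obj (UObj U (Base (PDom F))) \<Longrightarrow>
       AMap (UArr U (PMap F)) ` Env (PDom F) A \<subseteq> Env (PCod F) (OMap (UArr U (PMap F)) A)"
  using assms by (simp_all add: precpm_arrow_def Let_def)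

lemma PreCPM_simps [simp]:
  "Obj (Cat (PreCPM ord U)) = {X. precpm_object ord U X}"
  "Arr (Cat (PreCPM ord U)) = {F. precpm_arrow ord U F}"
  "Dom (Cat (PreCPM ord U)) = PDom" "Cod (Cat (PreCPM ord U)) = PCod"
  "Idt (Cat (PreCPM ord U)) = (\<lambda>X. \<lparr>PDom = X, PCod = X, PMap = Idt (Cat U) (Base X)\<rparr>)"
  "Comp (Cat (PreCPM ord U)) =
     (\<lambda>G F. \<lparr>PDom = PDom F, PCod = PCod G, PMap = PMap G \<cdot>\<^bsub>Cat U\<^esub> PMap F\<rparr>)"
  "UObj (PreCPM ord U) = (\<lambda>X. UObj U (Base X))" "UArr (PreCPM ord U) = (\<lambda>F. UArr U (PMap F))"
  by (simp_all add: PreCPM_def)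

locale universe =
  fixes U :: "('x, 'y, 'a, 'b) smc_universe" and ord :: "'g monoid \<Rightarrow> 'g list"
  assumes universe: "smc_universe U"
begin

sublocale cat: category "Cat U"
  using universe by (simp add: smc_universe_def is_functor_def)

lemma underlying_hom: "f \<in> Hom (Cat U) A B \<Longrightarrow> UArr U f \<in> Hom SMCs (UObj U A) (UObj U B)"
  and underlying_obj: "A \<in> Obj (Cat U) \<Longrightarrow> smc (UObj U A)"
  and underlying_idt: "A \<in> Obj (Cat U) \<Longrightarrow> UArr U (Idt (Cat U) A) = smf_id (UObj U A)"
  and underlying_comp: "\<lbrakk>f \<in> Hom (Cat U) A B; g \<in> Hom (Cat U) B D\<rbrakk>
    \<Longrightarrow> UArr U (g \<cdot>\<^bsub>Cat U\<^esub> f) = smf_comp (UArr U g) (UArr U f)"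
  using universe by (auto simp: smc_universe_def is_functor_def Hom_def)

lemma precpm_idt:
  assumes X: "precpm_object ord U X"
  shows "precpm_arrow ord U \<lparr>PDom = X, PCod = X, PMap = Idt (Cat U) (Base X)\<rparr>"
proof (rule precpm_arrowI[OF X X])
  note XD = precpm_objectD[OF X]
  show "Idt (Cat U) (Base X) \<in> Hom (Cat U) (Base X) (Base X)"
    using XD(1) by (rule cat.idt_hom)
  show "Idt (Cat U) (Base X) \<cdot>\<^bsub>Cat U\<^esub> Act X \<gamma> = Act X \<gamma> \<cdot>\<^bsub>Cat U\<^esub> Idt (Cat U) (Base X)"
    if "\<gamma> \<in> carrier (Grp X)" for \<gamma>
    using XD(3)[OF that] by (simp add: cat.comp_idt_left cat.comp_idt_right)
  show "AMap (UArr U (Idt (Cat U) (Base X))) ` Env X A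
      \<subseteq> Env X (OMap (UArr U (Idt (Cat U) (Base X))) A)"
    if A: "A \<in> Obj (UObj U (Base X))" for A
    using XD(4)[OF A] A by (auto simp: underlying_idt[OF XD(1)] smf_id_def Hom_def)
qed simp

text \<open>
  Equivariance is pasted from two commuting squares; preservation of environments is transitive.
\<close>

lemma precpm_comp:
  assumes F: "precpm_arrow ord U F" and G: "precpm_arrow ord U G" and GF: "PDom G = PCod F"
  shows "precpm_arrow ord U
    \<lparr>PDom = PDom F, PCod = PCod G, PMap = PMap G \<cdot>\<^bsub>Cat U\<^esub> PMap F\<rparr>"
proof (rule precpm_arrowI)
  note FD = precpm_arrowD[OF F] and GD = precpm_arrowD[OF G, unfolded GF]
  let ?f = "PMap F" and ?g = "PMap G"
  show "precpm_object ord U (PDom F)" "precpm_object ord U (PCod G)" "Grp (PDom F) = Grp (PCod G)"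
    using FD GD by simp_all
  show "?g \<cdot>\<^bsub>Cat U\<^esub> ?f \<in> Hom (Cat U) (Base (PDom F)) (Base (PCod G))"
    using FD(4) GD(4) by (rule cat.comp_hom)
  show "?g \<cdot>\<^bsub>Cat U\<^esub> ?f \<cdot>\<^bsub>Cat U\<^esub> Act (PDom F) \<gamma> = Act (PCod G) \<gamma> \<cdot>\<^bsub>Cat U\<^esub> (?g \<cdot>\<^bsub>Cat U\<^esub> ?f)"
    if \<gamma>: "\<gamma> \<in> carrier (Grp (PDom F))" for \<gamma>
  proof -
    have \<gamma>': "\<gamma> \<in> carrier (Grp (PCod F))" "\<gamma> \<in> carrier (Grp (PCod G))"
      using \<gamma> FD(3) GD(3) by simp_all
    note act = precpm_objectD(3)[OF FD(1) \<gamma>] precpm_objectD(3)[OF FD(2) \<gamma>'(1)]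
      precpm_objectD(3)[OF GD(2) \<gamma>'(2)]
    have "?g \<cdot>\<^bsub>Cat U\<^esub> ?f \<cdot>\<^bsub>Cat U\<^esub> Act (PDom F) \<gamma> = ?g \<cdot>\<^bsub>Cat U\<^esub> (Act (PCod F) \<gamma> \<cdot>\<^bsub>Cat U\<^esub> ?f)"
      using cat.comp_assoc[OF act(1) FD(4) GD(4)] FD(5)[OF \<gamma>] by simp
    also have "\<dots> = Act (PCod G) \<gamma> \<cdot>\<^bsub>Cat U\<^esub> ?g \<cdot>\<^bsub>Cat U\<^esub> ?f"
      using cat.comp_assoc[OF FD(4) act(2) GD(4)] GD(5)[OF \<gamma>'(1)] by simp
    also have "\<dots> = Act (PCod G) \<gamma> \<cdot>\<^bsub>Cat U\<^esub> (?g \<cdot>\<^bsub>Cat U\<^esub> ?f)"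
      by (rule cat.comp_assoc[OF FD(4) GD(4) act(3)])
    finally show ?thesis .
  qed
  show "AMap (UArr U (?g \<cdot>\<^bsub>Cat U\<^esub> ?f)) ` Env (PDom F) A
      \<subseteq> Env (PCod G) (OMap (UArr U (?g \<cdot>\<^bsub>Cat U\<^esub> ?f)) A)"
    if A: "A \<in> Obj (UObj U (Base (PDom F)))" for A
  proof -
    have f: "UArr U ?f \<in> Hom SMCs (UObj U (Base (PDom F))) (UObj U (Base (PCod F)))"
      using FD(4) by (rule underlying_hom)
    interpret f: smf_between "UObj U (Base (PDom F))" "UObj U (Base (PCod F))" "UArr U ?f"
      using f by (rule smf_betweenI)
    have "AMap (UArr U ?g) (AMap (UArr U ?f) \<xi>)
        \<in> Env (PCod G) (OMap (UArr U ?g) (OMap (UArr U ?f) A))" if "\<xi> \<in> Env (PDom F) A" for \<xi>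
      using FD(6)[OF A] GD(6)[OF f.map_obj[OF A]] that by blast
    moreover have "\<xi> \<in> Arr (UObj U (Base (PDom F)))" if "\<xi> \<in> Env (PDom F) A" for \<xi>
      using precpm_objectD(4)[OF FD(1) A] that by (auto simp: Hom_def)
    ultimately show ?thesis
      using A f
      by (auto simp: underlying_comp[OF FD(4) GD(4)] smf_comp_def compose_def Hom_SMCs)
  qed
qed

lemma category_PreCPM: "category (Cat (PreCPM ord U))"
proof (unfold_locales, goal_cases)
  case (4 F X Y G Z)
  then show ?case
    by (auto simp: Hom_def intro: precpm_comp)
next
  case (7 F X Y G Z H W)
  then have "PMap F \<in> Hom (Cat U) (Base X) (Base Y)" "PMap G \<in> Hom (Cat U) (Base Y) (Base Z)"
    "PMap H \<in> Hom (Cat U) (Base Z) (Base W)"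
    using precpm_arrowD(4)[of ord U] by (auto simp: Hom_def)
  then show ?case
    by (simp add: cat.comp_assoc)
qed (auto simp: Hom_def precpm_idt dest: precpm_arrowD(1,2,4)
    intro!: precpm_map.equality cat.idt_comp cat.comp_idt)

lemma underlying_functor:
  "is_functor (Cat (PreCPM ord U)) SMCs (UObj (PreCPM ord U)) (UArr (PreCPM ord U))"
proof -
  have "category (SMCs :: (('a, 'b) smc, ('a, 'b) smf) category)"
    using universe by (simp add: smc_universe_def is_functor_def)
  moreover have "UArr U (PMap G \<cdot>\<^bsub>Cat U\<^esub> PMap F) = smf_comp (UArr U (PMap G)) (UArr U (PMap F))"
    if "precpm_arrow ord U F" "precpm_arrow ord U G" "PDom G = PCod F"
    for F G :: "('x, 'y, 'g, 'a, 'b) precpm_map"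
    using underlying_comp[OF precpm_arrowD(4)[OF that(1)]] precpm_arrowD(4)[OF that(2)] that(3)
    by simp
  ultimately show ?thesis
    using category_PreCPM
    by (auto simp: is_functor_def dest: precpm_objectD(1) precpm_arrowD(4)
        intro: underlying_obj underlying_idt underlying_hom)
qed

lemma underlying_faithful: "is_faithful (Cat (PreCPM ord U)) (UArr (PreCPM ord U))"
proof -
  have faithful: "is_faithful (Cat U) (UArr U)"
    using universe by (simp add: smc_universe_def)
  have "F = G" if "precpm_arrow ord U F" "precpm_arrow ord U G" "PDom F = PDom G" "PCod F = PCod G"
    "UArr U (PMap F) = UArr U (PMap G)" for F G :: "('x, 'y, 'g, 'a, 'b) precpm_map"
  proof -
    have "PMap F = PMap G"
      using faithful that precpm_arrowD(4)[OF that(1)] precpm_arrowD(4)[OF that(2)]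
      by (auto simp: is_faithful_def Hom_def)
    then show ?thesis
      using that by (intro precpm_map.equality) auto
  qed
  then show ?thesis
    by (auto simp: is_faithful_def)
qed

end

lemma incl_universe_simps [simp]:
  "Cat (incl_universe \<Theta>) = \<Theta>" "UObj (incl_universe \<Theta>) = (\<lambda>C. C)"
  "UArr (incl_universe \<Theta>) = (\<lambda>F. F)"
  by (simp_all add: incl_universe_def)

lemma subcategory_Hom:
  assumes "subcategory S C"
  shows "f \<in> Hom S A B \<Longrightarrow> f \<in> Hom C A B"
    and "\<lbrakk>f \<in> Hom S A B; g \<in> Hom S B D\<rbrakk> \<Longrightarrow> g \<cdot>\<^bsub>S\<^esub> f = g \<cdot>\<^bsub>C\<^esub> f"
  using assms by (auto simp: subcategory_def Hom_def)

text \<open>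
  The underlying image of a universe keeps the operations of \<open>SMCs\<close> and restricts only the objects
  and arrows. A subcategory has operations of its own, but they agree with the ambient ones where
  defined, so the restricted structure is again a category.
\<close>

lemma subcategory_restrict:
  fixes C :: "('a, 'b) category"
  assumes S: "subcategory S C"
  shows "subcategory (C\<lparr>Obj := Obj S, Arr := Arr S\<rparr>) C"
proof -
  let ?R = "C\<lparr>Obj := Obj S, Arr := Arr S\<rparr>"
  interpret S: category S using S by (simp add: subcategory_def)
  interpret C: category C using S by (simp add: subcategory_def)
  have sub: "Obj S \<subseteq> Obj C" "Arr S \<subseteq> Arr C"
    and dom: "\<And>f. f \<in> Arr S \<Longrightarrow> Dom C f = Dom S f" "\<And>f. f \<in> Arr S \<Longrightarrow> Cod C f = Cod S f"
    and idt: "\<And>A. A \<in> Obj S \<Longrightarrow> Idt C A = Idt S A"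
    using S by (auto simp: subcategory_def)
  have Hom: "Hom ?R A B = Hom S A B" for A B
    using dom by (auto simp: Hom_def)
  note into = subcategory_Hom(1)[OF S] and comp = subcategory_Hom(2)[OF S, symmetric]
  have "category ?R"
  proof (unfold_locales, unfold Hom, goal_cases)
    case (4 f A B g D)
    then show ?case using S.comp_hom[of f A B g D] by (simp add: comp)
  next
    case (7 f A B g D h E)
    then show ?case using C.comp_assoc[of f A B g D h E] by (simp add: into)
  qed (auto simp: dom idt S.idt_hom intro: C.comp_idt_left C.comp_idt_right dest: into)
  then show ?thesis
    using sub C.category_axioms by (simp add: subcategory_def)
qed

lemma smc_universe_incl:
  assumes "subcategory \<Theta> SMCs"
  shows "smc_universe (incl_universe \<Theta>)"
proof -
  have "is_functor \<Theta> SMCs (\<lambda>C. C) (\<lambda>F. F)"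
    using assms by (auto simp: is_functor_def subcategory_def Hom_def)
  moreover have "is_faithful \<Theta> (\<lambda>F. F)"
    by (simp add: is_faithful_def)
  ultimately show ?thesis
    using subcategory_restrict[OF assms] by (simp add: smc_universe_def underlying_image_def)
qed


section \<open>The trivial CPM construction\<close>

text \<open>
  A group with one element exists on every type; \<^const>\<open>undefined\<close> is the one element that can be
  named in all of them. With this choice, one constant function is both the group law and
  \<^const>\<open>undefined\<close> off the carrier, as objects of PreCPM require.
\<close>

definition trivial_group :: "'g monoid" where
  "trivial_group = \<lparr>carrier = {undefined},
     monoid.mult = (\<lambda>\<gamma> \<delta>. undefined), one = undefined\<rparr>"

text \<open>
  The smallest environment: the effect on the unit is forced, and strictness of the category, which
  gives \<open>I \<otimes> I = I\<close>, keeps the family closed under tensor products.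
\<close>

definition trivial_env :: "('a, 'b) smc \<Rightarrow> 'a \<Rightarrow> 'b set" where
  "trivial_env C A = (if A = Unit C then {Idt C (Unit C)} else {})"

definition trivial_precpm ::
  "('a, 'b) smc \<Rightarrow> (('a, 'b) smc, ('a, 'b) smf, 'g, 'a, 'b) precpm" where
  "trivial_precpm C = \<lparr>Base = C, Grp = trivial_group, Act = (\<lambda>\<gamma>\<in>{undefined}. smf_id C),
     Env = trivial_env C\<rparr>"

lemma comm_group_trivial: "comm_group trivial_group"
  by (rule comm_groupI) (auto simp: trivial_group_def)

locale trivial_action =
  fixes C :: "('a, 'b) smc" and \<Psi> :: "'g \<Rightarrow> ('a, 'b) smf" and x :: 'g
  assumes strict: "strict_smc C" and act: "\<Psi> x = smf_id C"
begin

sublocale smc C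
  using strict by (simp add: strict_smc_def)

lemma strict_unit: "A \<in> Obj C \<Longrightarrow> Unit C \<otimes>\<^sub>o\<^bsub>C\<^esub> A = A" "A \<in> Obj C \<Longrightarrow> Lun C A = Idt C A"
  using strict by (auto simp: strict_smc_def)

lemma fld_obj_trivial: "A \<in> Obj C \<Longrightarrow> fld_obj C [x] \<Psi> A = A"
  by (simp add: fld_obj_def act smf_id_def)

lemma fld_arr_trivial: "f \<in> Arr C \<Longrightarrow> fld_arr C [x] \<Psi> f = f"
  by (simp add: fld_arr_def act smf_id_def)

lemma pi_iso_trivial:
  "\<lbrakk>A \<in> Obj C; B \<in> Obj C\<rbrakk> \<Longrightarrow> pi_iso C [x] \<Psi> A B = Idt C (A \<otimes>\<^sub>o\<^bsub>C\<^esub> B)"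
  by (simp add: pi_iso_def act smf_id_def)

lemma inj_fld_trivial: "inj_on (fld_obj C [x] \<Psi>) (Obj C)"
  by (simp add: inj_on_def fld_obj_trivial)

lemma multi_environment_trivial:
  assumes "carrier G = {x}" "x \<otimes>\<^bsub>G\<^esub> x = x"
  shows "multi_environment C G [x] \<Psi> (trivial_env C)"
proof -
  have [simp]: "Unit C \<otimes>\<^sub>o\<^bsub>C\<^esub> Unit C = Unit C" "Lun C (Unit C) = Idt C (Unit C)"
    by (simp_all add: strict_unit)
  have [simp]: "Idt C (Unit C) \<otimes>\<^sub>a\<^bsub>C\<^esub> Idt C (Unit C) = Idt C (Unit C)"
    by (simp add: tarr_idt)
  have tau: "tau_iso C G [x] \<Psi> A x = Idt C A" if "A \<in> Obj C" for A
    using that assms(2) by (simp add: tau_iso_def act smf_id_def)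
  show ?thesis
    using tau[of "Unit C"] assms(1)
    by (simp add: multi_environment_def trivial_env_def Hom_def fld_obj_trivial pi_iso_trivial
        act smf_id_def)
qed

text \<open>
  Folding over one identity functor is the identity, and discarding the only effect, the identity of
  the unit, is an identity by strictness.
\<close>

lemma cpm_arr_trivial: "cpm_arr C [x] \<Psi> (trivial_env C) = Arr C"
proof (intro equalityI subsetI)
  show "f \<in> Arr C" if "f \<in> cpm_arr C [x] \<Psi> (trivial_env C)" for f
    using that
    by induction (auto simp: fld_arr_trivial fld_obj_trivial pi_iso_trivial trivial_env_def
        strict_unit tarr_idt split: if_splits)
  show "f \<in> cpm_arr C [x] \<Psi> (trivial_env C)" if "f \<in> Arr C" for f
    using cpm_arr.fold[OF that, of "[x]" \<Psi> "trivial_env C"] that by (simp add: fld_arr_trivial)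
qed

text \<open>
  The equality is one of records: outside the domains of the operations, both sides are
  \<^const>\<open>undefined\<close>.
\<close>

lemma CPM_trivial: "CPM C [x] \<Psi> (trivial_env C) = C"
proof -
  have "inv_into (Obj C) (fld_obj C [x] \<Psi>) A = A" if "A \<in> Obj C" for A
    using inv_into_f_f[OF inj_fld_trivial that] that by (simp add: fld_obj_trivial)
  moreover have "fld_obj C [x] \<Psi> ` Obj C = Obj C"
    by (simp add: fld_obj_trivial)
  moreover have "is_iso C (Idt C (A \<otimes>\<^sub>o\<^bsub>C\<^esub> B))" if "A \<in> Obj C" "B \<in> Obj C" for A B
    using that by simp
  ultimately show ?thesis
    unfolding CPM_def Let_def cpm_arr_trivial
    by (intro smc.equality)
      (auto simp: fun_eq_iff fld_obj_trivial fld_arr_trivial pi_iso_trivial dom_undef cod_undef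
        idt_undef comp_undef tobj_undef tarr_undef asc_undef lun_undef run_undef sym_undef)
qed

lemma fld_trivial: "fld C [x] \<Psi> (trivial_env C) = smf_id C"
  by (auto simp: fld_def smf_id_def CPM_trivial fld_obj_trivial fld_arr_trivial)

end

text \<open>
  The CPM category and the folding functor of the trivial structure lie in \<open>\<Theta>\<close>, being \<open>C\<close> and its
  identity.
\<close>

lemma trivial_precpm_object:
  fixes ord :: "'g monoid \<Rightarrow> 'g list"
  assumes ordering: "\<And>G. finite (carrier G) \<Longrightarrow> distinct (ord G) \<and> set (ord G) = carrier G"
    and sub: "subcategory \<Theta> SMCs" and C: "C \<in> Obj \<Theta>" "strict_smc C"
  shows "precpm_object ord (incl_universe \<Theta>) (trivial_precpm C)"
proof -
  define x :: 'g where "x = undefined"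
  define \<Psi> where "\<Psi> = (\<lambda>\<gamma>\<in>{x}. smf_id C)"
  interpret trivial_action C \<Psi> x
    using C by unfold_locales (simp_all add: \<Psi>_def)
  interpret \<Theta>: category \<Theta>
    using sub by (simp add: subcategory_def)
  have "distinct (ord trivial_group)" "set (ord trivial_group) = {x}"
    using ordering[of trivial_group] by (auto simp: trivial_group_def x_def)
  then have ord: "ord trivial_group = [x]"
    by (cases "ord (trivial_group :: 'g monoid)"; cases "tl (ord (trivial_group :: 'g monoid))") auto
  have id: "Idt \<Theta> C = smf_id C" 
    using sub C by (simp add: subcategory_def)
  then have "smf_id C \<in> Hom \<Theta> C C" "is_iso \<Theta> (smf_id C)" "smf_id C \<cdot>\<^bsub>\<Theta>\<^esub> smf_id C = smf_id C"
    using \<Theta>.idt_hom[OF C(1)] \<Theta>.iso_idt[OF C(1)] \<Theta>.idt_comp[of "smf_id C" C]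
    by (auto simp: Hom_def)
  then have "\<Psi> \<in> hom trivial_group (Aut \<Theta> C)" "smf_id C \<in> Arr \<Theta>"
    by (auto simp: hom_def Aut_def trivial_group_def \<Psi>_def x_def Hom_def)
  moreover have "multi_environment C trivial_group [x] \<Psi> (trivial_env C)"
    by (rule multi_environment_trivial) (simp_all add: trivial_group_def x_def)
  moreover have "trivial_env C A = {}" if "A \<notin> Obj C" for A
    using that by (auto simp: trivial_env_def)
  moreover have "\<Psi> \<in> extensional (carrier trivial_group)"
    by (simp add: \<Psi>_def trivial_group_def x_def)
  moreover have "trivial_precpm C
      = \<lparr>Base = C, Grp = trivial_group, Act = \<Psi>, Env = trivial_env C\<rparr>"
    by (simp add: trivial_precpm_def \<Psi>_def x_def)
  ultimately show ?thesis
    using comm_group_trivial C inj_fld_trivial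
    by (simp add: precpm_object_def cpm_of_def fld_of_def fld_obj_of_def ord CPM_trivial
        fld_trivial) (simp add: trivial_group_def)
qed

text \<open>
  Equivariance under the trivial action is the unit law, and a strict monoidal functor maps the
  identity of the unit to the identity of the unit.
\<close>

lemma trivial_precpm_arrow:
  fixes ord :: "'g monoid \<Rightarrow> 'g list"
  assumes ordering: "\<And>G. finite (carrier G) \<Longrightarrow> distinct (ord G) \<and> set (ord G) = carrier G"
    and sub: "subcategory \<Theta> SMCs" and strict: "\<forall>C\<in>Obj \<Theta>. strict_smc C"
    and F: "F \<in> Hom \<Theta> C D"
  shows "precpm_arrow ord (incl_universe \<Theta>)
    \<lparr>PDom = trivial_precpm C, PCod = trivial_precpm D, PMap = F\<rparr>"
proof -
  interpret \<Theta>: category \<Theta>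
    using sub by (simp add: subcategory_def)
  interpret smf_between C D F
    by (intro smf_betweenI subcategory_Hom(1)[OF sub] F)
  have C: "C \<in> Obj \<Theta>" "D \<in> Obj \<Theta>"
    using F \<Theta>.dom_closed[of F] \<Theta>.cod_closed[of F] by (simp_all add: Hom_def)
  have id: "Idt \<Theta> C = smf_id C" "Idt \<Theta> D = smf_id D"
    using sub C by (simp_all add: subcategory_def)
  show ?thesis
  proof (rule precpm_arrowI)
    show "precpm_object ord (incl_universe \<Theta>) (trivial_precpm C)"
      "precpm_object ord (incl_universe \<Theta>) (trivial_precpm D)"
      using trivial_precpm_object[OF ordering sub] C strict by auto
    show "F \<cdot>\<^bsub>Cat (incl_universe \<Theta>)\<^esub> Act (trivial_precpm C) \<gamma>
        = Act (trivial_precpm D) \<gamma> \<cdot>\<^bsub>Cat (incl_universe \<Theta>)\<^esub> F"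
      if "\<gamma> \<in> carrier (Grp (trivial_precpm C))" for \<gamma>
      using that \<Theta>.comp_idt_left[OF F] \<Theta>.comp_idt_right[OF F]
      by (simp add: trivial_precpm_def trivial_group_def id)
  qed (use F in \<open>auto simp: trivial_precpm_def trivial_env_def\<close>)
qed

text \<open>
  The trivial structures make the underlying image all of \<open>\<Theta>\<close>, which is a subcategory by assumption.
\<close>

lemma smc_universe_PreCPM:
  fixes ord :: "'g monoid \<Rightarrow> 'g list"
  assumes ordering: "\<And>G. finite (carrier G) \<Longrightarrow> distinct (ord G) \<and> set (ord G) = carrier G"
    and sub: "subcategory \<Theta> SMCs" and strict: "\<forall>C\<in>Obj \<Theta>. strict_smc C"
  shows "smc_universe (PreCPM ord (incl_universe \<Theta>))"
proof -
  let ?P = "PreCPM ord (incl_universe \<Theta>)"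
  interpret universe "incl_universe \<Theta>" ord
    using smc_universe_incl[OF sub] by unfold_locales
  interpret \<Theta>: category \<Theta>
    using sub by (simp add: subcategory_def)
  have "UObj ?P ` Obj (Cat ?P) = Obj \<Theta>"
  proof (intro equalityI subsetI)
    show "C \<in> UObj ?P ` Obj (Cat ?P)" if "C \<in> Obj \<Theta>" for C
      using trivial_precpm_object[OF ordering sub that] strict that
      by (intro image_eqI[of _ _ "trivial_precpm C"]) (simp_all add: trivial_precpm_def)
  qed (use precpm_objectD(1) in fastforce)
  moreover have "UArr ?P ` Arr (Cat ?P) = Arr \<Theta>"
  proof (intro equalityI subsetI)
    show "F \<in> UArr ?P ` Arr (Cat ?P)" if "F \<in> Arr \<Theta>" for F
    proof -
      have "F \<in> Hom \<Theta> (Dom \<Theta> F) (Cod \<Theta> F)"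
        using that by (simp add: Hom_def)
      from trivial_precpm_arrow[OF ordering sub strict this]
      show ?thesis by force
    qed
    show "F \<in> Arr \<Theta>" if "F \<in> UArr ?P ` Arr (Cat ?P)" for F
      using that by (auto dest: precpm_arrowD(4) simp: Hom_def)
  qed
  ultimately show ?thesis
    using underlying_functor underlying_faithful subcategory_restrict[OF sub]
    by (simp add: smc_universe_def underlying_image_def)
qed


section \<open>The CPM functor\<close>

locale smcs_subcategory =
  fixes \<Theta> :: "(('a, 'b) smc, ('a, 'b) smf) category" and ord :: "'g monoid \<Rightarrow> 'g list"
  assumes ordering: "\<And>G. finite (carrier G) \<Longrightarrow> distinct (ord G) \<and> set (ord G) = carrier G"
    and sub: "subcategory \<Theta> SMCs"
begin

abbreviation "I\<Theta> \<equiv> incl_universe \<Theta>"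

sublocale universe "I\<Theta>" ord
  using smc_universe_incl[OF sub] by unfold_locales

lemma sub_simps:
  "category \<Theta>" "C \<in> Obj \<Theta> \<Longrightarrow> smc C" "F \<in> Arr \<Theta> \<Longrightarrow> is_smf F"
  "F \<in> Arr \<Theta> \<Longrightarrow> Dom \<Theta> F = SDom F" "F \<in> Arr \<Theta> \<Longrightarrow> Cod \<Theta> F = SCod F"
  "C \<in> Obj \<Theta> \<Longrightarrow> Idt \<Theta> C = smf_id C"
  using sub by (auto simp: subcategory_def)

lemma precpm_cpm_data:
  assumes X: "precpm_object ord I\<Theta> X"
  shows "cpm_data (Base X) (ord (Grp X)) (Act X) (Env X)"
proof -
  note XD = precpm_objectD[OF X, simplified]
  have "smc (Base X)" "smc (cpm_of ord I\<Theta> X)"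
    using XD by (auto intro: sub_simps)
  moreover have "Act X \<gamma> \<in> Hom SMCs (Base X) (Base X)" if "\<gamma> \<in> set (ord (Grp X))" for \<gamma>
    using XD(2,3) that ordering by (auto intro: subcategory_Hom(1)[OF sub])
  ultimately show ?thesis
    using XD(4,7) by (auto simp: cpm_data_def smc_action_def smc_action_axioms_def
        cpm_data_axioms_def fld_obj_of_def cpm_of_def)
qed

text \<open>
  Equivariance is an equation between composites in \<open>\<Theta>\<close>, which are composites in \<open>SMCs\<close>; the source
  and the target are folded along the same list, since their groups are equal.
\<close>

lemma precpm_equivariant_smf:
  assumes F: "precpm_arrow ord I\<Theta> F"
  shows "equivariant_smf (Base (PDom F)) (Base (PCod F)) (PMap F) (ord (Grp (PDom F)))
    (Act (PDom F)) (Env (PDom F)) (Act (PCod F)) (Env (PCod F))"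
proof -
  note FD = precpm_arrowD[OF F, simplified]
  have F_hom: "PMap F \<in> Hom SMCs (Base (PDom F)) (Base (PCod F))"
    using FD(4) by (rule subcategory_Hom(1)[OF sub])
  have "smf_comp (PMap F) (Act (PDom F) \<gamma>) = smf_comp (Act (PCod F) \<gamma>) (PMap F)"
    if "\<gamma> \<in> set (ord (Grp (PDom F)))" for \<gamma>
  proof -
    have \<gamma>: "\<gamma> \<in> carrier (Grp (PDom F))" "\<gamma> \<in> carrier (Grp (PCod F))"
      using that ordering precpm_objectD(2)[OF FD(1)] FD(3) by auto
    note act = precpm_objectD(3)[OF FD(1) \<gamma>(1), simplified]
      precpm_objectD(3)[OF FD(2) \<gamma>(2), simplified]
    show ?thesis
      using FD(5)[OF \<gamma>(1)] subcategory_Hom(2)[OF sub act(1) FD(4)]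
        subcategory_Hom(2)[OF sub FD(4) act(2)] by simp
  qed
  moreover have "cpm_data (Base (PCod F)) (ord (Grp (PDom F))) (Act (PCod F)) (Env (PCod F))"
    using precpm_cpm_data[OF FD(2)] FD(3) by simp
  ultimately show ?thesis
    using smf_betweenI[OF F_hom] precpm_cpm_data[OF FD(1)] FD(6)
    by (auto simp: equivariant_smf_def equivariant_smf_axioms_def)
qed

lemma cpm_restrict_smf:
  assumes "precpm_arrow ord I\<Theta> F"
  shows "is_smf (cpm_restrict ord \<Theta> F)"
    and "smf_comp (fld_of ord I\<Theta> (PCod F)) (PMap F)
      = smf_comp (cpm_restrict ord \<Theta> F) (fld_of ord I\<Theta> (PDom F))"
proof -
  interpret equivariant_smf "Base (PDom F)" "Base (PCod F)" "PMap F" "ord (Grp (PDom F))"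
    "Act (PDom F)" "Env (PDom F)" "Act (PCod F)" "Env (PCod F)"
    using assms by (rule precpm_equivariant_smf)
  have Grp: "Grp (PCod F) = Grp (PDom F)"
    using precpm_arrowD(3)[OF assms] .
  have "cpm_restrict ord \<Theta> F = cpm_map"
    by (simp add: cpm_restrict_def cpm_map_def cpm_of_def Grp Let_def)
  then show "is_smf (cpm_restrict ord \<Theta> F)"
    and "smf_comp (fld_of ord I\<Theta> (PCod F)) (PMap F)
      = smf_comp (cpm_restrict ord \<Theta> F) (fld_of ord I\<Theta> (PDom F))"
    using cpm_map_smf cpm_map_natural by (simp_all add: fld_of_def Grp)
qed

lemma cpm_restrict_sel [simp]:
  "SDom (cpm_restrict ord \<Theta> F) = cpm_of ord I\<Theta> (PDom F)"
  "SCod (cpm_restrict ord \<Theta> F) = cpm_of ord I\<Theta> (PCod F)"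
  by (simp_all add: cpm_restrict_def Let_def)

lemma cpm_restrict_idt:
  assumes X: "precpm_object ord I\<Theta> X"
  shows "cpm_restrict ord \<Theta> \<lparr>PDom = X, PCod = X, PMap = smf_id (Base X)\<rparr>
    = smf_id (cpm_of ord I\<Theta> X)"
proof -
  interpret cpm_data "Base X" "ord (Grp X)" "Act X" "Env X"
    using X by (rule precpm_cpm_data)
  have "Obj (cpm_of ord I\<Theta> X) \<subseteq> Obj (Base X)" "Arr (cpm_of ord I\<Theta> X) \<subseteq> Arr (Base X)"
    by (auto simp: cpm_of_def CPM_sel cpm_arr_type)
  then show ?thesis
    by (simp add: cpm_restrict_def smf_id_def Let_def Int_absorb1)
qed

text \<open>
  The composite of restrictions agrees with the restriction of the composite because the first
  restriction lands where the second is defined.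
\<close>

lemma cpm_restrict_comp:
  assumes F: "precpm_arrow ord I\<Theta> F" and G: "precpm_arrow ord I\<Theta> G" and GF: "PDom G = PCod F"
  shows "cpm_restrict ord \<Theta>
      \<lparr>PDom = PDom F, PCod = PCod G, PMap = smf_comp (PMap G) (PMap F)\<rparr>
    = smf_comp (cpm_restrict ord \<Theta> G) (cpm_restrict ord \<Theta> F)"
proof -
  let ?X = "cpm_of ord I\<Theta> (PDom F)" and ?Y = "cpm_of ord I\<Theta> (PCod F)"
  interpret X: cpm_data "Base (PDom F)" "ord (Grp (PDom F))" "Act (PDom F)" "Env (PDom F)"
    using precpm_arrowD(1)[OF F] by (rule precpm_cpm_data)
  interpret F: smf_between ?X ?Y "cpm_restrict ord \<Theta> F"
    using cpm_restrict_smf(1)[OF F] by (intro smf_betweenI) (simp add: Hom_SMCs)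
  have "OMap (PMap F) A \<in> Obj ?Y" if "A \<in> Obj ?X" for A
    using F.map_obj[OF that] that by (simp add: cpm_restrict_def Let_def)
  moreover have "AMap (PMap F) f \<in> Arr ?Y" if "f \<in> Arr ?X" for f
    using F.map_arr[OF that] that by (simp add: cpm_restrict_def Let_def)
  moreover have "Obj ?X \<subseteq> Obj (Base (PDom F))" "Arr ?X \<subseteq> Arr (Base (PDom F))"
    by (auto simp: cpm_of_def CPM_sel X.cpm_arr_type)
  moreover have "SDom (PMap F) = Base (PDom F)"
    using subcategory_Hom(1)[OF sub] precpm_arrowD(4)[OF F] by (auto simp: Hom_SMCs)
  ultimately show ?thesis
    using GF by (auto simp: cpm_restrict_def smf_comp_def compose_def Let_def subset_iff
        intro!: restrict_ext)
qed

end

theorem lemma11: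
  fixes \<Theta> :: "(('a, 'b) smc, ('a, 'b) smf) category"
    and ord :: "'g monoid \<Rightarrow> 'g list"
  assumes ordering: "\<And>G. finite (carrier G) \<Longrightarrow> distinct (ord G) \<and> set (ord G) = carrier G"
    and sub: "subcategory \<Theta> SMCs"
    and closed: "\<And>F. F \<in> Arr (Cat (PreCPM ord (incl_universe \<Theta>))) \<Longrightarrow>
      cpm_restrict ord \<Theta> F \<in> Arr SMCs \<Longrightarrow> cpm_restrict ord \<Theta> F \<in> Arr \<Theta>"
  shows "smc_universe (incl_universe \<Theta>)
    \<and> ((\<forall>C\<in>Obj \<Theta>. strict_smc C) \<longrightarrow> smc_universe (PreCPM ord (incl_universe \<Theta>)))
    \<and> smc_universe_morphism (PreCPM ord (incl_universe \<Theta>)) (incl_universe \<Theta>)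
        (cpm_of ord (incl_universe \<Theta>)) (cpm_restrict ord \<Theta>) (fld_of ord (incl_universe \<Theta>))"
proof (intro conjI impI)
  interpret smcs_subcategory \<Theta> ord
    using ordering sub by unfold_locales
  let ?P = "PreCPM ord (incl_universe \<Theta>)"
  show "smc_universe (incl_universe \<Theta>)"
    by (rule universe)
  show "smc_universe ?P" if "\<forall>C\<in>Obj \<Theta>. strict_smc C"
    using ordering sub that by (rule smc_universe_PreCPM)
  have SMCs: "category (SMCs :: (('a, 'b) smc, ('a, 'b) smf) category)"
    using sub by (simp add: subcategory_def)
  have obj: "cpm_of ord I\<Theta> X \<in> Obj \<Theta>" if "precpm_object ord I\<Theta> X" for X
    using precpm_objectD(5)[OF that] by simp
  have arr: "cpm_restrict ord \<Theta> F \<in> Hom \<Theta> (cpm_of ord I\<Theta> (PDom F)) (cpm_of ord I\<Theta> (PCod F))"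
    if "precpm_arrow ord I\<Theta> F" for F
  proof -
    have "cpm_restrict ord \<Theta> F \<in> Arr \<Theta>"
      using that cpm_restrict_smf(1)[OF that] by (intro closed) simp_all
    then show ?thesis
      by (simp add: Hom_def sub_simps)
  qed
  have comp: "cpm_restrict ord \<Theta> \<lparr>PDom = PDom F, PCod = PCod G, PMap = PMap G \<cdot>\<^bsub>\<Theta>\<^esub> PMap F\<rparr>
      = smf_comp (cpm_restrict ord \<Theta> G) (cpm_restrict ord \<Theta> F)"
    if F: "precpm_arrow ord I\<Theta> F" and G: "precpm_arrow ord I\<Theta> G" and GF: "PDom G = PCod F"
    for F G
    using cpm_restrict_comp[OF F G GF] precpm_arrowD(4)[OF F] precpm_arrowD(4)[OF G] GF
    by (simp add: subcategory_Hom(2)[OF sub])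
  have "is_functor (Cat ?P) \<Theta> (cpm_of ord I\<Theta>) (cpm_restrict ord \<Theta>)"
    unfolding is_functor_def
  proof (intro conjI ballI impI, goal_cases)
    case (5 X)
    then show ?case
      using cpm_restrict_idt[of X] obj[of X] precpm_objectD(1)[of ord I\<Theta> X]
      by (simp add: sub_simps)
  next
    case (6 F G)
    then show ?case
      using comp[of F G] subcategory_Hom(2)[OF sub arr[of F], of "cpm_restrict ord \<Theta> G"] arr[of G]
      by simp
  qed (use category_PreCPM sub_simps(1) obj arr in auto)
  moreover have "is_functor (Cat ?P) SMCs (cpm_of ord I\<Theta>) (cpm_restrict ord \<Theta>)"
    unfolding is_functor_def
  proof (intro conjI ballI impI, goal_cases)
    case (5 X)
    then show ?case
      using cpm_restrict_idt[of X] precpm_objectD(1)[of ord I\<Theta> X]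
      by (simp add: sub_simps)
  next
    case (6 F G)
    then show ?case
      using comp[of F G] by simp
  qed (use category_PreCPM SMCs obj arr subcategory_Hom(1)[OF sub] in \<open>auto simp: sub_simps\<close>)
  moreover have "fld_of ord I\<Theta> X \<in> Hom SMCs (Base X) (cpm_of ord I\<Theta> X)"
    if "precpm_object ord I\<Theta> X" for X
    using precpm_objectD(6)[OF that]
    by (auto simp: Hom_SMCs sub_simps fld_of_def cpm_of_def fld_def)
  ultimately show "smc_universe_morphism ?P (incl_universe \<Theta>) (cpm_of ord (incl_universe \<Theta>))
      (cpm_restrict ord \<Theta>) (fld_of ord (incl_universe \<Theta>))"
    using underlying_functor cpm_restrict_smf(2)
    by (simp add: smc_universe_morphism_def natural_transformation_def comp_def)
qed

end
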